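(* Let $A$ be a finite alphabet and let $K$ be a nontrivial, proper, finitely generated subgroup of the free group $F_A$, with Stallings automaton $\mathcal S(K)=(Q,A,\delta,q_0)$ and transition monoid $M(K)$. Let $R_A$ be the set of all reduced words over $\widetilde A=A\cup A^{-1}$, and let $$E=\{\delta_u \mid u\in R_A\setminus\{1\},\ \delta_u^2=\delta_u\}\subseteq M(K).$$ Consider the restriction to $E$ of the natural partial order on $M(K)$, and let $k$ be the maximum size of a chain in $E$. Then $K$ is malnormal in $F_A$ if and only if $k=2$ and $|E|=|Q|+1$.
   Context: $A^{-1}$ is the set of formal inverses of the letters of $A$. Elements of $F_A$ are identified with reduced words in the free monoid $\widetilde A^*$; $1$ denotes the empty word. A subgroup $K$ of a group $G$ is malnormal if $gKg^{-1}\cap K=1$ for all $g\in G\setminus K$. Stallings automaton. Let $K=\langle u_1,\dots,u_k\rangle\leq F_A$ be finitely generated, with the $u_i$ nonempty reduced words in $\widetilde A^*$. Take a basepoint $q_0$, attach to it closed paths (petals) labeled by each of the $u_i$ with otherwise disjoint new vertices, and add for every edge $p\xrightarrow{a}q$ ($a\in\widetilde A$) its inverse edge $q\xrightarrow{a^{-1}}p$. Then successively identify ("fold") pairs of distinct edges $p\xrightarrow{a}q$, $p\xrightarrow{a}r$ ($a\in\widetilde A$), together with their inverse edges (so $q$ and $r$ are merged), until the automaton is deterministic. The result, with $q_0$ as unique initial and terminal state, is the Stallings automaton $\mathcal S(K)=(Q,A,\delta,q_0)$; up to isomorphism it depends only on $K$ and $A$. For $q\in Q$ and $u\in\widetilde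 A^*$, $q\cdot u$ denotes the vertex reached by reading $u$ from $q$, if this is possible (otherwise it is undefined), and $\delta_u$ is the partial transformation $q\mapsto q\cdot u$ of $Q$ (possibly the empty transformation). The transition monoid is $M(K)=\{\delta_u \mid u\in\widetilde A^*\}$ under composition (left to right); it is an inverse monoid of injective partial transformations of $Q$. The natural partial order on an inverse monoid $M$ is: $x\leq y$ iff $x=ey$ for some idempotent $e\in M$. For injective partial transformations $f,g$ in $M(K)$ this means that $f$ is the restriction of $g$ to the domain of $f$. A chain in a partially ordered set is a finite nonempty totally ordered subset $y_1<\dots<y_k$, and its size is $k$. *)

theory Defs
  imports "HOL-Algebra.Generated_Groups"
begin

section \<open>Words and the free group\<close>

datatype 'a letter = Gen 'a | Inv 'a

fun linv :: "'a letter \<Rightarrow> 'a letter" where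
  "linv (Gen a) = Inv a"
| "linv (Inv a) = Gen a"

definition letters :: "'a set \<Rightarrow> 'a letter set" where
  "letters A = Gen ` A \<union> Inv ` A"

definition reduced :: "'a letter list \<Rightarrow> bool" where
  "reduced = successively (\<lambda>x y. y \<noteq> linv x)"

definition reduced_words :: "'a set \<Rightarrow> 'a letter list set" where
  "reduced_words A = {w \<in> lists (letters A). reduced w}"

fun cancel_cons :: "'a letter \<Rightarrow> 'a letter list \<Rightarrow> 'a letter list" where
  "cancel_cons x [] = [x]"
| "cancel_cons x (y # ys) = (if y = linv x then ys else x # y # ys)"

definition reduce :: "'a letter list \<Rightarrow> 'a letter list" where
  "reduce w = foldr cancel_cons w []"

definition free_group :: "'a set \<Rightarrow> 'a letter list monoid" where
  "free_group A = \<lparr>carrier = reduced_words A, mult = (\<lambda>u v. reduce (u @ v)), one = []\<rparr>"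

definition malnormal :: "('g, 'm) monoid_scheme \<Rightarrow> 'g set \<Rightarrow> bool" where
  "malnormal G K \<longleftrightarrow> subgroup K G \<and>
     (\<forall>g \<in> carrier G - K. (g <#\<^bsub>G\<^esub> K #>\<^bsub>G\<^esub> inv\<^bsub>G\<^esub> g) \<inter> K = {\<one>\<^bsub>G\<^esub>})"

definition fin_gen_subgroup :: "('g, 'm) monoid_scheme \<Rightarrow> 'g set \<Rightarrow> bool" where
  "fin_gen_subgroup G K \<longleftrightarrow> (\<exists>X. finite X \<and> X \<subseteq> carrier G \<and> K = generate G X)"

section \<open>Stallings automata\<close>

record ('q, 'a) automaton =
  verts :: "'q set"
  edges :: "('q \<times> 'a letter \<times> 'q) set"
  base :: 'q

text \<open>
  The flower of the words \<open>us\<close>: the basepoint is \<open>(0, 0)\<close>, and \<open>(i, j)\<close> with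
  \<open>0 < j < length (us ! i)\<close> is the vertex reached on the \<open>i\<close>-th petal after \<open>j\<close> letters.
\<close>

definition petal_vertex :: "'a letter list list \<Rightarrow> nat \<Rightarrow> nat \<Rightarrow> nat \<times> nat" where
  "petal_vertex us i j = (if j = 0 \<or> j = length (us ! i) then (0, 0) else (i, j))"

definition petal_edges :: "'a letter list list \<Rightarrow> ((nat \<times> nat) \<times> 'a letter \<times> (nat \<times> nat)) set" where
  "petal_edges us = {(petal_vertex us i j, us ! i ! j, petal_vertex us i (Suc j)) | i j.
     i < length us \<and> j < length (us ! i)}"

definition flower :: "'a letter list list \<Rightarrow> (nat \<times> nat, 'a) automaton" where
  "flower us =
    \<lparr>verts = insert (0, 0) {(i, j). i < length us \<and> 0 < j \<and> j < length (us ! i)},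
     edges = petal_edges us \<union> {(q, linv x, p) | p x q. (p, x, q) \<in> petal_edges us},
     base = (0, 0)\<rparr>"

definition merge :: "'q \<Rightarrow> 'q \<Rightarrow> ('q, 'a) automaton \<Rightarrow> ('q, 'a) automaton" where
  "merge q r S = (let f = (\<lambda>v. if v = r then q else v) in
    \<lparr>verts = f ` verts S,
     edges = (\<lambda>(p, x, p'). (f p, x, f p')) ` edges S,
     base = f (base S)\<rparr>)"

text \<open>
  Edges form a set of triples, so two distinct edges with the same source and label have
  distinct targets, and merging the targets identifies the two edges and their inverse edges.
\<close>

inductive fold_step :: "('q, 'a) automaton \<Rightarrow> ('q, 'a) automaton \<Rightarrow> bool" where
  "(p, x, q) \<in> edges S \<Longrightarrow> (p, x, r) \<in> edges S \<Longrightarrow> q \<noteq> r \<Longrightarrow> fold_step S (merge q r S)"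

definition deterministic :: "('q, 'a) automaton \<Rightarrow> bool" where
  "deterministic S \<longleftrightarrow>
     (\<forall>p x q r. (p, x, q) \<in> edges S \<longrightarrow> (p, x, r) \<in> edges S \<longrightarrow> q = r)"

text \<open>
  The Stallings automaton is only defined up to isomorphism: the outcome depends on the
  generating words and on the order of the foldings, so it is rendered as a relation.
\<close>

definition stallings_automaton ::
  "'a set \<Rightarrow> 'a letter list set \<Rightarrow> (nat \<times> nat, 'a) automaton \<Rightarrow> bool" where
  "stallings_automaton A K S \<longleftrightarrow> (\<exists>us.
     set us \<subseteq> reduced_words A - {[]} \<and> K = generate (free_group A) (set us) \<and>
     fold_step\<^sup>*\<^sup>* (flower us) S \<and> deterministic S)"

section \<open>Transition monoid\<close>

definition step :: "('q, 'a) automaton \<Rightarrow> 'a letter \<Rightarrow> 'q \<rightharpoonup> 'q" where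
  "step S x p = (if \<exists>q. (p, x, q) \<in> edges S then Some (THE q. (p, x, q) \<in> edges S) else None)"

text \<open>\<open>\<circ>\<^sub>m\<close> composes from right to left, whereas words act from left to right.\<close>

fun delta :: "('q, 'a) automaton \<Rightarrow> 'a letter list \<Rightarrow> 'q \<rightharpoonup> 'q" where
  "delta S [] = (\<lambda>q. if q \<in> verts S then Some q else None)"
| "delta S (x # u) = delta S u \<circ>\<^sub>m step S x"

definition transition_monoid :: "'a set \<Rightarrow> ('q, 'a) automaton \<Rightarrow> ('q \<rightharpoonup> 'q) monoid" where
  "transition_monoid A S =
    \<lparr>carrier = delta S ` lists (letters A), mult = (\<lambda>f g. g \<circ>\<^sub>m f), one = delta S []\<rparr>"

definition natural_le :: "('m, 'b) monoid_scheme \<Rightarrow> 'm \<Rightarrow> 'm \<Rightarrow> bool" where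
  "natural_le M x y \<longleftrightarrow> (\<exists>e \<in> carrier M. e \<otimes>\<^bsub>M\<^esub> e = e \<and> x = e \<otimes>\<^bsub>M\<^esub> y)"

definition fin_chain_in :: "('b \<Rightarrow> 'b \<Rightarrow> bool) \<Rightarrow> 'b set \<Rightarrow> 'b set \<Rightarrow> bool" where
  "fin_chain_in leq E C \<longleftrightarrow> C \<subseteq> E \<and> finite C \<and> C \<noteq> {} \<and> (\<forall>x\<in>C. \<forall>y\<in>C. leq x y \<or> leq y x)"

section \<open>Well-definedness\<close>

lemma linv_linv [simp]: "linv (linv x) = x"
  by (cases x) auto

lemma linv_neq [simp]: "linv x \<noteq> x" "x \<noteq> linv x"
  by (cases x; auto)+

lemma linv_letters [simp]: "linv x \<in> letters A \<longleftrightarrow> x \<in> letters A"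
  by (cases x) (auto simp: letters_def)

lemma reduced_Nil [simp]: "reduced []"
  by (simp add: reduced_def)

lemma reduced_Cons: "reduced (x # w) \<longleftrightarrow> (w = [] \<or> hd w \<noteq> linv x) \<and> reduced w"
  by (cases w) (auto simp: reduced_def)

lemma reduced_cancel_cons: "reduced w \<Longrightarrow> reduced (cancel_cons x w)"
  by (cases w) (auto simp: reduced_Cons)

lemma cancel_cons_cancel:
  assumes "reduced w" shows "cancel_cons x (cancel_cons (linv x) w) = w"
proof (cases w)
  case (Cons y ys)
  then show ?thesis using assms by (cases ys) (auto simp: reduced_Cons)
qed simp

lemma reduced_foldr: "reduced w \<Longrightarrow> reduced (foldr cancel_cons u w)"
  by (induction u) (auto intro: reduced_cancel_cons)

lemma letters_cancel_cons:
  "x \<in> letters A \<Longrightarrow> w \<in> lists (letters A) \<Longrightarrow> cancel_cons x w \<in> lists (letters A)"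
  by (cases w) auto

lemma letters_foldr:
  "u \<in> lists (letters A) \<Longrightarrow> w \<in> lists (letters A) \<Longrightarrow> foldr cancel_cons u w \<in> lists (letters A)"
proof (induction u)
  case (Cons x u)
  then show ?case by (simp only: foldr.simps o_apply Cons_in_lists_iff letters_cancel_cons)
qed simp

lemma reduce_reduced: "reduced w \<Longrightarrow> reduce w = w"
proof (induction w)
  case (Cons x w)
  then have "reduce w = w" by (simp add: reduced_Cons)
  with Cons.prems show ?case by (cases w) (auto simp: reduce_def reduced_Cons)
qed (simp add: reduce_def)

lemma foldr_cancel_cons:
  assumes "reduced w"
  shows "foldr cancel_cons (cancel_cons x v) w = cancel_cons x (foldr cancel_cons v w)"
proof (cases v)
  case (Cons y ys)
  then show ?thesis
    using cancel_cons_cancel[OF reduced_foldr[OF assms], of x ys] by auto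
qed simp

lemma foldr_reduce: "reduced w \<Longrightarrow> foldr cancel_cons (reduce u) w = foldr cancel_cons u w"
  by (induction u) (auto simp: reduce_def foldr_cancel_cons)

lemma reduce_append: "reduce (u @ v) = foldr cancel_cons u (reduce v)"
  by (simp add: reduce_def)

lemma reduced_reduce: "reduced (reduce u)"
  by (simp add: reduce_def reduced_foldr)

lemma reduce_append_reduce:
  "reduce (reduce u @ v) = reduce (u @ v)" "reduce (u @ reduce v) = reduce (u @ v)"
  by (simp_all add: reduce_append foldr_reduce reduced_reduce reduce_reduced)

lemma reduce_inverse: "reduce (map linv (rev u) @ u) = []"
proof (induction u)
  case (Cons x u)
  have "cancel_cons (linv x) (cancel_cons x (reduce u)) = reduce u"
    using cancel_cons_cancel[OF reduced_reduce, of "linv x" u] by simp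
  with Cons show ?case by (simp add: reduce_append) (simp add: reduce_def)
qed (simp add: reduce_def)

lemma group_free_group: "group (free_group A)"
proof (rule groupI)
  fix u v w
  assume u: "u \<in> carrier (free_group A)" and v: "v \<in> carrier (free_group A)"
  then show "u \<otimes>\<^bsub>free_group A\<^esub> v \<in> carrier (free_group A)"
    using letters_foldr[of u A "reduce v"]
    by (simp add: free_group_def reduced_words_def reduced_reduce reduce_append reduce_reduced
        reduced_foldr)
  show "u \<otimes>\<^bsub>free_group A\<^esub> v \<otimes>\<^bsub>free_group A\<^esub> w = u \<otimes>\<^bsub>free_group A\<^esub> (v \<otimes>\<^bsub>free_group A\<^esub> w)"
    by (simp add: free_group_def reduce_append_reduce)
next
  show "\<one>\<^bsub>free_group A\<^esub> \<in> carrier (free_group A)"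
    by (simp add: free_group_def reduced_words_def)
next
  fix u assume u: "u \<in> carrier (free_group A)"
  then show "\<one>\<^bsub>free_group A\<^esub> \<otimes>\<^bsub>free_group A\<^esub> u = u"
    by (simp add: free_group_def reduced_words_def reduce_reduced)
  have "map linv (rev u) \<in> lists (letters A)"
    using u by (auto simp: free_group_def reduced_words_def)
  then have "reduce (map linv (rev u)) \<in> carrier (free_group A)"
    using letters_foldr[of "map linv (rev u)" A "[]"] reduced_reduce
    by (simp add: free_group_def reduced_words_def reduce_def)
  moreover have "reduce (map linv (rev u)) \<otimes>\<^bsub>free_group A\<^esub> u = \<one>\<^bsub>free_group A\<^esub>"
    by (simp add: free_group_def reduce_append_reduce reduce_inverse)
  ultimately show "\<exists>v \<in> carrier (free_group A). v \<otimes>\<^bsub>free_group A\<^esub> u = \<one>\<^bsub>free_group A\<^esub>"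
    by blast
qed

lemma flower_wf:
  shows "finite (verts (flower us))"
    and "edges (flower us) \<subseteq> verts (flower us) \<times> UNIV \<times> verts (flower us)"
proof -
  have "verts (flower us) = insert (0, 0) (SIGMA i:{..<length us}. {0<..<length (us ! i)})"
    by (auto simp: flower_def)
  then show "finite (verts (flower us))" by simp
  show "edges (flower us) \<subseteq> verts (flower us) \<times> UNIV \<times> verts (flower us)"
    by (auto simp: flower_def petal_edges_def petal_vertex_def intro: Suc_lessI split: if_splits)
qed

lemma folding_terminates:
  assumes "finite (verts S)" "edges S \<subseteq> verts S \<times> UNIV \<times> verts S"
  shows "\<exists>T. fold_step\<^sup>*\<^sup>* S T \<and> deterministic T"
  using assms
proof (induction "card (verts S)" arbitrary: S rule: less_induct)
  case less
  show ?case
  proof (cases "deterministic S")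
    case False
    then obtain p x q r where e: "(p, x, q) \<in> edges S" "(p, x, r) \<in> edges S" "q \<noteq> r"
      by (auto simp: deterministic_def)
    let ?T = "merge q r S"
    have qr: "q \<in> verts S" "r \<in> verts S" using e less.prems by auto
    then have "verts ?T = verts S - {r}" using e(3) qr by (auto simp: merge_def Let_def)
    then have "card (verts ?T) < card (verts S)" "finite (verts ?T)"
      using qr(2) less.prems(1) card_Diff1_less[of "verts S" r] by simp_all
    moreover have "edges ?T \<subseteq> verts ?T \<times> UNIV \<times> verts ?T"
    proof -
      define f where "f = (\<lambda>v. if v = r then q else v)"
      have "f a \<in> f ` verts S \<and> f b \<in> f ` verts S" if "(a, y, b) \<in> edges S" for a y b
        using that less.prems(2) by (intro conjI imageI) auto
      then show ?thesis
        unfolding merge_def Let_def f_def[symmetric] by (auto simp: image_subset_iff)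
    qed
    ultimately obtain T where T: "fold_step\<^sup>*\<^sup>* ?T T" "deterministic T"
      using less.hyps[of ?T] by auto
    have "fold_step\<^sup>*\<^sup>* S T"
      by (rule converse_rtranclp_into_rtranclp[OF fold_step.intros[OF e] T(1)])
    with T(2) show ?thesis by (intro exI conjI)
  next
    case True
    then show ?thesis by (intro exI[of _ S]) simp
  qed
qed

lemma stallings_automaton_exists:
  assumes "fin_gen_subgroup (free_group A) K"
  shows "\<exists>S. stallings_automaton A K S"
proof -
  let ?G = "free_group A"
  interpret group ?G by (rule group_free_group)
  obtain X where X: "finite X" "X \<subseteq> carrier ?G" "K = generate ?G X"
    using assms by (auto simp: fin_gen_subgroup_def)
  obtain us where us: "set us = X - {[]}" using X(1) finite_list[of "X - {[]}"] by auto
  have "X \<subseteq> generate ?G (X - {[]})"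
    using generate.incl[of _ "X - {[]}" ?G] generate.one[of ?G "X - {[]}"]
    by (auto simp: free_group_def)
  then have "generate ?G X \<subseteq> generate ?G (X - {[]})"
    using X(2) by (intro generate_subgroup_incl generate_is_subgroup) auto
  then have K: "K = generate ?G (set us)"
    using X(3) us mono_generate[of "X - {[]}" X] by auto
  obtain S where "fold_step\<^sup>*\<^sup>* (flower us) S" "deterministic S"
    using folding_terminates[OF flower_wf, of us] by auto
  moreover have "set us \<subseteq> reduced_words A - {[]}"
    using us X(2) by (auto simp: free_group_def)
  ultimately show ?thesis using K by (auto simp: stallings_automaton_def)
qed

end

theory Submission
  imports Defs
begin

text \<open>
  \<open>K\<close> is malnormal iff no nonempty reduced word labels loops at two distinct vertices of \<open>S\<close>: two
  such loops give two conjugates of one element in \<open>K\<close>, and conversely a nontrivial element of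
  \<open>gKg\<inverse> \<inter> K\<close> has a cyclically reduced core that is read as a loop at two vertices, which
  coincide only if \<open>g \<in> K\<close>.

  An element of \<open>E\<close> is the identity on some set of vertices. Since \<open>vc\<^sup>nv\<inverse>\<close> is reduced and
  has idempotent action for suitable \<open>n\<close> when \<open>c\<close> is cyclically reduced, these sets
  cover the vertices; and the empty set is one of them unless the automaton is complete. So in the malnormal case they
  are the empty set and all singletons. Conversely, \<open>k = 2\<close> makes nonempty domains pairwise incomparable.
  Intersecting domains contain the domain of a further element of \<open>E\<close>, so nonempty domains are
  disjoint, and since there are as many of them as vertices they are singletons.
\<close>

section \<open>Words\<close>

definition winv :: "'a letter list \<Rightarrow> 'a letter list" where
  "winv w = map linv (rev w)"

lemma winv_simps [simp]:
  "winv [] = []" "winv (x # w) = winv w @ [linv x]" "winv (u @ v) = winv v @ winv u"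
  by (simp_all add: winv_def)

lemma winv_winv [simp]: "winv (winv w) = w"
  by (induction w) auto

lemma winv_eq_Nil [simp]: "winv w = [] \<longleftrightarrow> w = []"
  by (simp add: winv_def)

lemma hd_winv: "w \<noteq> [] \<Longrightarrow> hd (winv w) = linv (last w)"
  by (induction w rule: rev_induct) auto

lemma last_winv: "w \<noteq> [] \<Longrightarrow> last (winv w) = linv (hd w)"
  by (induction w) auto

lemma winv_letters [simp]: "winv w \<in> lists (letters A) \<longleftrightarrow> w \<in> lists (letters A)"
  by (induction w) auto

lemma linv_eq_iff [simp]: "linv x = linv y \<longleftrightarrow> x = y"
  by (metis linv_linv)

lemma reduced_append:
  "reduced (u @ v) \<longleftrightarrow> reduced u \<and> reduced v \<and> (u = [] \<or> v = [] \<or> hd v \<noteq> linv (last u))"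
  by (auto simp: reduced_def successively_append_iff)

lemma reduced_winv [simp]: "reduced (winv w) \<longleftrightarrow> reduced w"
proof -
  have "reduced (winv w)" if "reduced w" for w :: "'a letter list"
    using that
  proof (induction w)
    case (Cons x w)
    then show ?case
      by (cases "w = []") (auto simp: reduced_Cons reduced_append last_winv)
  qed simp
  from this[of w] this[of "winv w"] show ?thesis by auto
qed

lemma reduce_cong: "reduce v = reduce v' \<Longrightarrow> reduce (u @ v @ w) = reduce (u @ v' @ w)"
  by (metis reduce_append_reduce)

lemma reduce_winv_left [simp]: "reduce (winv w @ w) = []"
  by (simp add: winv_def reduce_inverse)

lemma reduce_winv_right [simp]: "reduce (w @ winv w) = []"
  using reduce_winv_left[of "winv w"] by simp

lemma reduce_Nil [simp]: "reduce [] = []"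
  by (simp add: reduce_def)

text \<open>One cancellation in six shapes, one for each position of the cancelling pair in a
  right-nested append, so that rewriting can match it.\<close>

lemma reduce_cancel [simp]:
  "reduce (u @ w @ winv w @ v) = reduce (u @ v)" "reduce (u @ winv w @ w @ v) = reduce (u @ v)"
  "reduce (w @ winv w @ v) = reduce v" "reduce (winv w @ w @ v) = reduce v"
  "reduce (u @ w @ winv w) = reduce u" "reduce (u @ winv w @ w) = reduce u"
  using reduce_cong[of "w @ winv w" "[]" u v] reduce_cong[of "winv w @ w" "[]" u v]
    reduce_cong[of "w @ winv w" "[]" "[]" v] reduce_cong[of "winv w @ w" "[]" "[]" v]
    reduce_cong[of "w @ winv w" "[]" u "[]"] reduce_cong[of "winv w @ w" "[]" u "[]"]
  by simp_all

lemma reduce_reduce_mid [simp]: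
  "reduce (u @ reduce v @ w) = reduce (u @ v @ w)" "reduce (reduce v @ w) = reduce (v @ w)"
  "reduce (u @ reduce v) = reduce (u @ v)" "reduce (reduce v) = reduce v"
  by (simp_all add: reduce_append_reduce reduce_reduced reduced_reduce)
    (metis append.assoc reduce_append_reduce)

text \<open>Insert \<open>w @ winv w\<close> behind \<open>winv (reduce w)\<close> and replace this
  \<open>w\<close> by \<open>reduce w\<close>, which cancels against the front.\<close>

lemma reduce_winv_reduce: "winv (reduce w) = reduce (winv w)"
proof -
  have "winv (reduce w) = reduce (winv (reduce w) @ w @ winv w)"
    by (simp add: reduce_reduced reduced_reduce)
  also have "\<dots> = reduce (winv (reduce w) @ reduce w @ winv w)"
    by (simp only: reduce_reduce_mid)
  also have "\<dots> = reduce (winv w)" by (simp only: reduce_cancel)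
  finally show ?thesis .
qed

lemma letters_reduce: "w \<in> lists (letters A) \<Longrightarrow> reduce w \<in> lists (letters A)"
  unfolding reduce_def by (rule letters_foldr) auto

lemma free_group_simps [simp]:
  "carrier (free_group A) = reduced_words A"
  "u \<otimes>\<^bsub>free_group A\<^esub> v = reduce (u @ v)"
  "\<one>\<^bsub>free_group A\<^esub> = []"
  by (simp_all add: free_group_def)

lemma inv_free_group:
  assumes "u \<in> reduced_words A" shows "inv\<^bsub>free_group A\<^esub> u = winv u"
  by (rule group.inv_equality[OF group_free_group]) (use assms in \<open>auto simp: reduced_words_def\<close>)

lemma conjugate_eq_NilD:
  assumes "reduce (v @ u @ winv v) = []" "reduced u" shows "u = []"
proof -
  have "u = reduce (winv v @ reduce (v @ u @ winv v) @ v)"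
    using assms(2) by (simp add: reduce_reduced)
  then show ?thesis by (simp only: assms(1)) simp
qed

section \<open>Powers, cyclic reduction and rotation\<close>

abbreviation wpow :: "'a letter list \<Rightarrow> nat \<Rightarrow> 'a letter list" where
  "wpow w n \<equiv> concat (replicate n w)"

lemma wpow_add: "wpow w (m + n) = wpow w m @ wpow w n"
  by (simp add: replicate_add)

text \<open>Only the seam between two copies of \<open>c\<close> could cancel, and
  \<open>reduced (c @ c)\<close> excludes this. The end letters are carried along to control the
  seam in the induction and in later concatenations.\<close>

lemma reduced_wpow:
  assumes "reduced (c @ c)" "c \<noteq> []"
  shows "reduced (wpow c n) \<and> (n \<noteq> 0 \<longrightarrow> wpow c n \<noteq> [] \<and> hd (wpow c n) = hd c \<and> last (wpow c n) = last c)"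
proof (induction n)
  case (Suc n)
  show ?case
    by (cases "n = 0") (use assms Suc in \<open>auto simp: reduced_append\<close>)
qed simp

text \<open>The condition \<open>reduced (c @ c)\<close> says that \<open>c\<close> is cyclically
  reduced. As long as the first and last letters are mutually inverse, they are moved into the
  conjugator.\<close>

lemma cyclic_decomposition:
  assumes "reduced u" "u \<noteq> []"
  shows "\<exists>v c. u = v @ c @ winv v \<and> c \<noteq> [] \<and> reduced (c @ c)"
  using assms
proof (induction "length u" arbitrary: u rule: less_induct)
  case less
  show ?case
  proof (cases "reduced (u @ u)")
    case True
    with less.prems show ?thesis by (intro exI[of _ "[]"] exI[of _ u]) simp
  next
    case False
    with less.prems have h: "hd u = linv (last u)" by (simp add: reduced_append)
    obtain x t where u: "u = x # t" using less.prems by (cases u) auto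
    with h have "t \<noteq> []" by auto
    then obtain s y where t: "t = s @ [y]" by (cases t rule: rev_cases) auto
    have y: "y = linv x" using h u t by simp
    \<comment> \<open>The middle is nonempty because \<open>[x, linv x]\<close> is not
      reduced.\<close>
    have "reduced s" "s \<noteq> []" using less.prems u t y by (auto simp: reduced_Cons reduced_append)
    moreover have "length s < length u" using u t by simp
    ultimately obtain v c where "s = v @ c @ winv v" "c \<noteq> []" "reduced (c @ c)"
      using less.hyps by blast
    then show ?thesis using u t y by (intro exI[of _ "x # v"] exI[of _ c]) simp
  qed
qed

text \<open>Both squares contain the same pairs of adjacent letters, namely those of one cyclic
  word.\<close>

lemma reduced_rotate:
  assumes "reduced ((u @ v) @ (u @ v))" shows "reduced ((v @ u) @ (v @ u))"
  using assms by (cases "u = []"; cases "v = []") (auto simp: reduced_append)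

section \<open>Reading words in automata\<close>

text \<open>A relation instead of the partial map \<open>delta\<close>, because the flower and
  partially folded automata need not be deterministic.\<close>

fun reads :: "('q, 'a) automaton \<Rightarrow> 'q \<Rightarrow> 'a letter list \<Rightarrow> 'q \<Rightarrow> bool" where
  "reads S p [] q \<longleftrightarrow> p = q \<and> p \<in> verts S"
| "reads S p (x # w) q \<longleftrightarrow> (\<exists>s. (p, x, s) \<in> edges S \<and> reads S s w q)"

lemma reads_verts:
  "edges S \<subseteq> verts S \<times> L \<times> verts S \<Longrightarrow> reads S p w q \<Longrightarrow> p \<in> verts S \<and> q \<in> verts S"
  by (induction w arbitrary: p) auto

lemma reads_append:
  assumes "edges S \<subseteq> verts S \<times> L \<times> verts S"
  shows "reads S p (u @ v) q \<longleftrightarrow> (\<exists>s. reads S p u s \<and> reads S s v q)"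
  using reads_verts[OF assms] by (induction u arbitrary: p) auto

text \<open>
  Folding only merges vertices carrying the same coset of \<open>K\<close>: the label \<open>\<phi> q\<close> is the coset
  reached from \<open>K\<close> by any word read from the basepoint to \<open>q\<close>.
\<close>

definition coset_labelling ::
  "'a letter list set \<Rightarrow> ('q, 'a) automaton \<Rightarrow> ('q \<Rightarrow> 'a letter list set) \<Rightarrow> bool" where
  "coset_labelling K S \<phi> \<longleftrightarrow> \<phi> (base S) = K \<and>
     (\<forall>p x q. (p, x, q) \<in> edges S \<longrightarrow> \<phi> q = (\<lambda>h. reduce (h @ [x])) ` \<phi> p)"

text \<open>The invariant carried from the flower through all foldings. The loops for the words in
  \<open>X\<close> will give that elements of K are accepted, the coset labelling that accepted
  words represent elements of K.\<close>

definition folding_of ::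
  "'a set \<Rightarrow> 'a letter list set \<Rightarrow> 'a letter list set \<Rightarrow> ('q, 'a) automaton \<Rightarrow> bool" where
  "folding_of A K X S \<longleftrightarrow> finite (verts S) \<and> edges S \<subseteq> verts S \<times> letters A \<times> verts S \<and>
     (\<forall>p x q. (p, x, q) \<in> edges S \<longrightarrow> (q, linv x, p) \<in> edges S) \<and> base S \<in> verts S \<and>
     (\<forall>q \<in> verts S. \<exists>w. reads S (base S) w q) \<and>
     (\<forall>u \<in> X. reads S (base S) u (base S)) \<and> (\<exists>\<phi>. coset_labelling K S \<phi>)"

lemma reads_merge:
  assumes "reads S p w q'"
  shows "reads (merge q r S) (if p = r then q else p) w (if q' = r then q else q')"
  using assms
proof (induction w arbitrary: p)
  case (Cons x w)
  then obtain s where s: "(p, x, s) \<in> edges S" "reads S s w q'" by auto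
  have "((if p = r then q else p), x, (if s = r then q else s)) \<in> edges (merge q r S)"
    using s(1) unfolding merge_def Let_def by force
  with Cons.IH[OF s(2)] show ?case by auto
qed (auto simp: merge_def Let_def)

lemma folding_of_merge:
  assumes S: "folding_of A K X S" and e: "(p, x, q) \<in> edges S" "(p, x, r) \<in> edges S"
  shows "folding_of A K X (merge q r S)"
proof -
  define f where "f = (\<lambda>v. if v = r then q else v)"
  have T: "verts (merge q r S) = f ` verts S" "base (merge q r S) = f (base S)"
    "edges (merge q r S) = (\<lambda>(p, x, p'). (f p, x, f p')) ` edges S"
    by (simp_all add: merge_def f_def)
  have ed: "edges S \<subseteq> verts S \<times> letters A \<times> verts S"
    and iv: "(a, y, b) \<in> edges S \<Longrightarrow> (b, linv y, a) \<in> edges S" for a y b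
    using S by (auto simp: folding_of_def)
  have rd: "reads (merge q r S) (f a) w (f b)" if "reads S a w b" for a w b
    using reads_merge[OF that] by (simp add: f_def)
  obtain \<phi> where \<phi>: "\<phi> (base S) = K"
    and \<phi>e: "(a, y, b) \<in> edges S \<Longrightarrow> \<phi> b = (\<lambda>h. reduce (h @ [y])) ` \<phi> a" for a y b
    using S by (auto simp: folding_of_def coset_labelling_def)
  \<comment> \<open>Both targets are labelled by the label of \<open>p\<close> translated by
    \<open>x\<close>, so the same labelling survives the merge.\<close>
  have "\<phi> q = \<phi> r" using \<phi>e[OF e(1)] \<phi>e[OF e(2)] by simp
  then have \<phi>f: "\<phi> (f v) = \<phi> v" for v by (simp add: f_def)
  have "coset_labelling K (merge q r S) \<phi>"
    unfolding coset_labelling_def T using \<phi> \<phi>e \<phi>f by auto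
  moreover have "edges (merge q r S) \<subseteq> verts (merge q r S) \<times> letters A \<times> verts (merge q r S)"
    unfolding T using ed by auto
  moreover have "\<forall>a y b. (a, y, b) \<in> edges (merge q r S) \<longrightarrow> (b, linv y, a) \<in> edges (merge q r S)"
  proof (intro allI impI)
    fix a y b assume "(a, y, b) \<in> edges (merge q r S)"
    then obtain a' b' where "(a', y, b') \<in> edges S" "a = f a'" "b = f b'" unfolding T by auto
    with iv[of a' y b'] show "(b, linv y, a) \<in> edges (merge q r S)" unfolding T by force
  qed
  moreover have "\<forall>v \<in> verts (merge q r S). \<exists>w. reads (merge q r S) (base (merge q r S)) w v"
    unfolding T(1,2) using S rd by (fastforce simp: folding_of_def)
  moreover have "\<forall>u \<in> X. reads (merge q r S) (base (merge q r S)) u (base (merge q r S))"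
    unfolding T(2) using S rd by (auto simp: folding_of_def)
  moreover have "finite (verts (merge q r S))" "base (merge q r S) \<in> verts (merge q r S)"
    using S by (auto simp: folding_of_def T)
  ultimately show ?thesis unfolding folding_of_def by blast
qed

lemma folding_of_fold_steps:
  "fold_step\<^sup>*\<^sup>* S T \<Longrightarrow> folding_of A K X S \<Longrightarrow> folding_of A K X T"
  by (induction rule: rtranclp_induct) (auto elim!: fold_step.cases intro: folding_of_merge)

section \<open>The flower satisfies the folding invariant\<close>

lemma petal_edge:
  "i < length us \<Longrightarrow> j < length (us ! i) \<Longrightarrow>
    (petal_vertex us i j, us ! i ! j, petal_vertex us i (Suc j)) \<in> edges (flower us)"
  by (auto simp: flower_def petal_edges_def)

lemma reads_petal_take:
  assumes "i < length us" "j \<le> length (us ! i)"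
  shows "reads (flower us) (0, 0) (take j (us ! i)) (petal_vertex us i j)"
  using assms(2)
proof (induction j)
  case 0
  then show ?case by (simp add: petal_vertex_def flower_def)
next
  case (Suc j)
  have e: "(petal_vertex us i j, us ! i ! j, petal_vertex us i (Suc j)) \<in> edges (flower us)"
    using petal_edge[OF assms(1)] Suc by simp
  then have "petal_vertex us i (Suc j) \<in> verts (flower us)" using flower_wf(2)[of us] by blast
  with e have "reads (flower us) (petal_vertex us i j) [us ! i ! j] (petal_vertex us i (Suc j))"
    by (metis reads.simps)
  moreover have "reads (flower us) (0, 0) (take j (us ! i)) (petal_vertex us i j)" using Suc by simp
  ultimately show ?case
    using Suc.prems by (simp only: take_Suc_conv_app_nth Suc_le_eq reads_append[OF flower_wf(2)]) blast
qed

lemma folding_of_flower: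
  assumes us: "set us \<subseteq> reduced_words A - {[]}" and K: "K = generate (free_group A) (set us)"
  shows "folding_of A K (set us) (flower us)"
proof -
  interpret group "free_group A" by (rule group_free_group)
  have KG: "subgroup K (free_group A)"
    unfolding K by (rule generate_is_subgroup) (use us in auto)
  have Kred: "reduced h" if "h \<in> K" for h
    using subgroup.mem_carrier[OF KG that] by (simp add: reduced_words_def)
  \<comment> \<open>A vertex on a petal is labelled by the coset of the prefix that leads to
    it.\<close>
  define \<phi> where "\<phi> = (\<lambda>(i, j). (\<lambda>h. reduce (h @ take j (us ! i))) ` K)"
  have \<phi>0: "\<phi> (0, 0) = K" using Kred by (force simp: \<phi>_def reduce_reduced)
  have usi: "us ! i \<in> K" if "i < length us" for i
    unfolding K using that by (auto intro: generate.incl)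
  have \<phi>p: "\<phi> (petal_vertex us i j) = (\<lambda>h. reduce (h @ take j (us ! i))) ` K"
    if "i < length us" "j \<le> length (us ! i)" for i j
  proof -
    \<comment> \<open>The end of a petal is the basepoint again, so its two possible labels have to
      agree; they do, because right translation by an element of K maps K onto itself.\<close>
    have "(\<lambda>h. reduce (h @ us ! i)) ` K = K"
    proof (intro equalityI subsetI)
      fix h assume "h \<in> (\<lambda>h. reduce (h @ us ! i)) ` K"
      then show "h \<in> K" using subgroup.m_closed[OF KG _ usi[OF that(1)]] by auto
    next
      fix h assume h: "h \<in> K"
      have "us ! i \<in> reduced_words A" using subgroup.mem_carrier[OF KG usi[OF that(1)]] by simp
      then have "winv (us ! i) \<in> K"
        using subgroup.m_inv_closed[OF KG usi[OF that(1)]] by (simp add: inv_free_group)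
      then have "reduce (h @ winv (us ! i)) \<in> K" using subgroup.m_closed[OF KG h] by auto
      moreover have "reduce (reduce (h @ winv (us ! i)) @ us ! i) = h"
        using Kred[OF h] by (simp add: reduce_reduced)
      ultimately show "h \<in> (\<lambda>h. reduce (h @ us ! i)) ` K" by force
    qed
    moreover have "reduce ` K = K" using Kred by (force simp: reduce_reduced)
    ultimately show ?thesis using \<phi>0 by (auto simp: petal_vertex_def \<phi>_def)
  qed
  have step: "\<phi> q = (\<lambda>h. reduce (h @ [x])) ` \<phi> p \<and> \<phi> p = (\<lambda>h. reduce (h @ [linv x])) ` \<phi> q
      \<and> x \<in> letters A" if pe: "(p, x, q) \<in> petal_edges us" for p x q
  proof -
    obtain i j where ij: "i < length us" "j < length (us ! i)" and
      e: "p = petal_vertex us i j" "x = us ! i ! j" "q = petal_vertex us i (Suc j)"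
      using pe by (auto simp: petal_edges_def)
    have "us ! i \<in> lists (letters A)" using us ij(1) nth_mem by (auto simp: reduced_words_def)
    then have "x \<in> letters A" using ij e(2) by auto
    moreover have 1: "\<phi> q = (\<lambda>h. reduce (h @ [x])) ` \<phi> p"
      using ij by (simp add: e \<phi>p take_Suc_conv_app_nth image_image)
    moreover have "\<phi> p = (\<lambda>h. reduce (h @ [linv x])) ` \<phi> q"
    proof -
      have "reduce (reduce (reduce (h @ t) @ [x]) @ [linv x]) = reduce (h @ t)" for h t
        using reduce_cancel(5)[of "h @ t" "[x]"] by simp
      then show ?thesis unfolding 1 image_image e(1) using ij by (simp add: \<phi>p image_image)
    qed
    ultimately show ?thesis by blast
  qed
  have base: "base (flower us) = (0, 0)" by (simp add: flower_def)
  have "coset_labelling K (flower us) \<phi>"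
    unfolding coset_labelling_def base
  proof (intro conjI allI impI)
    fix p x q assume "(p, x, q) \<in> edges (flower us)"
    then consider "(p, x, q) \<in> petal_edges us" | y where "x = linv y" "(q, y, p) \<in> petal_edges us"
      by (auto simp: flower_def)
    then show "\<phi> q = (\<lambda>h. reduce (h @ [x])) ` \<phi> p" using step by cases blast+
  qed (rule \<phi>0)
  moreover have "edges (flower us) \<subseteq> UNIV \<times> letters A \<times> UNIV"
    using step by (auto simp: flower_def)
  then have "edges (flower us) \<subseteq> verts (flower us) \<times> letters A \<times> verts (flower us)"
    using flower_wf(2)[of us] by blast
  moreover have "\<forall>q \<in> verts (flower us). \<exists>w. reads (flower us) (base (flower us)) w q"
  proof
    fix q assume "q \<in> verts (flower us)"
    then consider "q = (0, 0)" | i j where "q = (i, j)" "i < length us" "0 < j" "j < length (us ! i)"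
      by (auto simp: flower_def)
    then show "\<exists>w. reads (flower us) (base (flower us)) w q"
    proof cases
      case 1
      then show ?thesis unfolding base by (intro exI[of _ "[]"]) (simp add: flower_def)
    next
      case 2
      then show ?thesis unfolding base using reads_petal_take[of i us j]
        by (auto simp: petal_vertex_def)
    qed
  qed
  moreover have "\<forall>u \<in> set us. reads (flower us) (base (flower us)) u (base (flower us))"
  proof
    fix u assume "u \<in> set us"
    then obtain i where "i < length us" "us ! i = u" by (auto simp: in_set_conv_nth)
    then show "reads (flower us) (base (flower us)) u (base (flower us))"
      unfolding base using reads_petal_take[of i us "length u"] by (simp add: petal_vertex_def)
  qed
  moreover have "\<forall>p x q. (p, x, q) \<in> edges (flower us) \<longrightarrow> (q, linv x, p) \<in> edges (flower us)"
    by (auto simp: flower_def)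
  moreover have "base (flower us) \<in> verts (flower us)" by (simp add: flower_def)
  ultimately show ?thesis unfolding folding_of_def using flower_wf(1) by blast
qed

section \<open>Reading inverses and reduced forms; the language of the folded automaton\<close>

lemma reads_winv:
  assumes "edges S \<subseteq> verts S \<times> L \<times> verts S"
    and "\<And>p x q. (p, x, q) \<in> edges S \<Longrightarrow> (q, linv x, p) \<in> edges S"
  shows "reads S p (winv w) q \<longleftrightarrow> reads S q w p"
proof -
  have "reads S q (winv w) p" if "reads S p w q" for p w q
    using that
  proof (induction w arbitrary: p)
    case (Cons x w)
    then obtain s where s: "(p, x, s) \<in> edges S" "reads S s w q" by auto
    have "p \<in> verts S" using s(1) assms(1) by auto
    with s Cons.IH[OF s(2)] assms(2)[OF s(1)] show ?case by (auto simp: reads_append[OF assms(1)])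
  qed auto
  from this[of p "winv w" q] this[of q w p] show ?thesis by auto
qed

lemma reads_reduce:
  assumes "edges S \<subseteq> verts S \<times> L \<times> verts S"
    and inv: "\<And>p x q. (p, x, q) \<in> edges S \<Longrightarrow> (q, linv x, p) \<in> edges S"
    and det: "\<And>p x q r. (p, x, q) \<in> edges S \<Longrightarrow> (p, x, r) \<in> edges S \<Longrightarrow> q = r"
  shows "reads S p w q \<Longrightarrow> reads S p (reduce w) q"
proof (induction w arbitrary: p)
  case (Cons x w)
  then obtain s where s: "(p, x, s) \<in> edges S" "reads S s w q" by auto
  have IH: "reads S s (reduce w) q" by (rule Cons.IH[OF s(2)])
  have eq: "reduce (x # w) = cancel_cons x (reduce w)" by (simp add: reduce_def)
  show ?case
  proof (cases "reduce w")
    case Nil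
    then show ?thesis using s(1) IH by (auto simp: eq)
  next
    case (Cons y ys)
    then show ?thesis using s(1) IH inv[OF s(1)] det by (auto simp: eq)
  qed
qed simp

text \<open>These properties are all that the later arguments use; the flower, the order of foldings
  and the concrete vertex type are forgotten from here on.\<close>

locale stallings =
  fixes A :: "'a set" and K :: "'a letter list set" and S :: "('q, 'a) automaton"
  assumes subgroup_K: "subgroup K (free_group A)"
    and finite_verts: "finite (verts S)"
    and edges_wf: "edges S \<subseteq> verts S \<times> letters A \<times> verts S"
    and edges_inv: "(p, x, q) \<in> edges S \<Longrightarrow> (q, linv x, p) \<in> edges S"
    and edges_det: "(p, x, q) \<in> edges S \<Longrightarrow> (p, x, r) \<in> edges S \<Longrightarrow> q = r"
    and base_verts: "base S \<in> verts S"
    and reachable: "q \<in> verts S \<Longrightarrow> \<exists>w. reads S (base S) w q"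
    and reads_K: "w \<in> K \<Longrightarrow> reads S (base S) w (base S)"
    and K_reads: "reads S (base S) w (base S) \<Longrightarrow> reduce w \<in> K"

lemma stallings_stallings_automaton:
  assumes "stallings_automaton A K S"
  shows "stallings A K S"
proof -
  obtain us where us: "set us \<subseteq> reduced_words A - {[]}" "K = generate (free_group A) (set us)"
    "fold_step\<^sup>*\<^sup>* (flower us) S" and det: "deterministic S"
    using assms by (auto simp: stallings_automaton_def)
  have S: "folding_of A K (set us) S"
    using folding_of_fold_steps[OF us(3) folding_of_flower[OF us(1,2)]] .
  interpret group "free_group A" by (rule group_free_group)
  have KG: "subgroup K (free_group A)"
    unfolding us(2) by (rule generate_is_subgroup) (use us in auto)
  have wf: "edges S \<subseteq> verts S \<times> letters A \<times> verts S"
    and inv: "\<And>p x q. (p, x, q) \<in> edges S \<Longrightarrow> (q, linv x, p) \<in> edges S"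
    and base: "base S \<in> verts S"
    and gen: "\<And>u. u \<in> set us \<Longrightarrow> reads S (base S) u (base S)"
    and fin: "finite (verts S)"
    and reach: "\<And>q. q \<in> verts S \<Longrightarrow> \<exists>w. reads S (base S) w q"
    using S by (auto simp: folding_of_def)
  have d: "\<And>p x q r. (p, x, q) \<in> edges S \<Longrightarrow> (p, x, r) \<in> edges S \<Longrightarrow> q = r"
    using det by (auto simp: deterministic_def)
  obtain \<phi> where \<phi>: "coset_labelling K S \<phi>" using S by (auto simp: folding_of_def)
  \<comment> \<open>The labelling is propagated along paths. The \<open>reduce\<close> on the right
    covers the empty path, since members of a label are not known to be reduced.\<close>
  have "(\<lambda>h. reduce (h @ w)) ` \<phi> p \<subseteq> reduce ` \<phi> q" if "reads S p w q" for p w q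
    using that
  proof (induction w arbitrary: p)
    case (Cons x w)
    then obtain s where s: "(p, x, s) \<in> edges S" "reads S s w q" by auto
    have "\<phi> s = (\<lambda>h. reduce (h @ [x])) ` \<phi> p" using \<phi> s(1) unfolding coset_labelling_def by blast
    with Cons.IH[OF s(2)] show ?case by (simp add: image_image)
  qed auto
  from this[of "base S" _ "base S"]
  have Kr: "(\<lambda>h. reduce (h @ w)) ` K \<subseteq> reduce ` K" if "reads S (base S) w (base S)" for w
    using that \<phi> by (auto simp: coset_labelling_def)
  have "reduce ` K \<subseteq> K"
    using subgroup.subset[OF KG] by (auto simp: reduced_words_def reduce_reduced)
  \<comment> \<open>Apply \<open>Kr\<close> to the neutral element of K.\<close>
  then have 1: "reduce w \<in> K" if "reads S (base S) w (base S)" for w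
    using Kr[OF that] subgroup.one_closed[OF KG] by force
  have 2: "reads S (base S) w (base S)" if "w \<in> K" for w
    using that unfolding us(2)
  proof (induction rule: generate.induct)
    case one
    then show ?case using base by simp
  next
    case (incl h)
    then show ?case by (rule gen)
  next
    case (inv h)
    then have "h \<in> reduced_words A" using us(1) by auto
    then show ?case using gen[OF inv]
      by (simp add: inv_free_group reads_winv[OF wf \<open>\<And>p x q. (p, x, q) \<in> edges S \<Longrightarrow> (q, linv x, p) \<in> edges S\<close>])
  next
    case (eng h1 h2)
    then have "reads S (base S) (h1 @ h2) (base S)" unfolding reads_append[OF wf] by blast
    from reads_reduce[OF wf inv d this] show ?case by simp
  qed
  show ?thesis
    by (rule stallings.intro) (fact KG wf inv d base 1 2 fin reach)+
qed

context stallings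
begin

lemmas reads_append_iff = reads_append[OF edges_wf]

lemma reads_winv_iff: "reads S p (winv w) q \<longleftrightarrow> reads S q w p"
  by (rule reads_winv[OF edges_wf]) (fact edges_inv)

lemma reads_reduced: "reads S p w q \<Longrightarrow> reads S p (reduce w) q"
  by (rule reads_reduce[OF edges_wf]; blast intro: edges_inv dest: edges_det)

lemma reads_in_verts: "reads S p w q \<Longrightarrow> p \<in> verts S \<and> q \<in> verts S"
  using reads_verts[OF edges_wf] .

lemma reads_letters: "reads S p w q \<Longrightarrow> w \<in> lists (letters A)"
  using edges_wf by (induction w arbitrary: p) auto

lemma reads_det: "reads S p w q \<Longrightarrow> reads S p w q' \<Longrightarrow> q = q'"
  by (induction w arbitrary: p) (auto dest: edges_det)

lemma reads_inj: "reads S p w q \<Longrightarrow> reads S p' w q \<Longrightarrow> p = p'"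
  using reads_det[of q "winv w" p p'] by (simp add: reads_winv_iff)

lemma reads_single: "reads S p [x] q \<longleftrightarrow> (p, x, q) \<in> edges S"
  using edges_wf by auto

lemma reads_conj:
  "reads S p (v @ c @ winv v) q \<longleftrightarrow> (\<exists>r s. reads S p v r \<and> reads S r c s \<and> reads S q v s)"
  by (auto simp: reads_append_iff reads_winv_iff)

text \<open>Idempotent partial injections are exactly the partial identities;
  \<open>delta_idem_iff\<close> makes the link with \<open>delta\<close>.\<close>

definition idem :: "'a letter list \<Rightarrow> bool" where
  "idem w \<longleftrightarrow> (\<forall>p q. reads S p w q \<longrightarrow> p = q)"

lemma ex_idem_power: "\<exists>n>0. idem (wpow c n)"
proof -
  define R where "R n = {(p, q). reads S p (wpow c n) q}" for n
  have R_add: "R (m + n) = R m O R n" for m n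
    by (auto simp: R_def wpow_add reads_append_iff relcomp_unfold)
  have "range R \<subseteq> Pow (verts S \<times> verts S)" using reads_in_verts by (auto simp: R_def)
  then have "finite (range R)" using finite_verts by (meson finite_Pow_iff finite_SigmaI finite_subset)
  \<comment> \<open>By pigeonhole two powers of \<open>c\<close> induce the same relation, so the
    sequence \<open>R\<close> is periodic with period \<open>d\<close> from \<open>i\<close>
    on.\<close>
  then have "\<not> inj R" using finite_imageD by blast
  then obtain i j where "i < j" "R i = R j" by (metis injI linorder_neqE_nat)
  then obtain d where d: "d > 0" "R (i + d) = R i" by (metis less_imp_add_positive)
  have shift: "R (m + d) = R m" if "i \<le> m" for m
  proof -
    obtain t where m: "m = i + t" using \<open>i \<le> m\<close> le_Suc_ex by blast
    have "R (m + d) = R (i + d) O R t" using R_add[of "i + d" t] by (simp add: m ac_simps)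
    then show ?thesis by (metis R_add d(2) m)
  qed
  have shifts: "R (m + k * d) = R m" if "i \<le> m" for m k
    by (induction k) (use that shift in \<open>simp_all add: add.assoc[symmetric] add.commute[of d]\<close>)
  \<comment> \<open>A multiple of the period that is at least \<open>i\<close>; the factor
    \<open>Suc i\<close> keeps it positive when \<open>i = 0\<close>.\<close>
  define n where "n = Suc i * d"
  have "i \<le> n" "n > 0" using d(1) by (cases d; simp add: n_def)+
  then have RR: "R n = R n O R n" using shifts[of n "Suc i"] R_add[of n n] by (simp add: n_def)
  \<comment> \<open>Determinism identifies the intermediate vertex with \<open>q\<close>,
    injectivity identifies it with \<open>p\<close>.\<close>
  have "p = q" if pq: "reads S p (wpow c n) q" for p q
  proof -
    have "(p, q) \<in> R n O R n" using pq RR by (auto simp: R_def)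
    then obtain s where "reads S p (wpow c n) s" "reads S s (wpow c n) q" by (auto simp: R_def)
    with pq reads_det reads_inj show ?thesis by metis
  qed
  with \<open>n > 0\<close> show ?thesis by (auto simp: idem_def)
qed

text \<open>
  Peel off the last letter of \<open>x\<close>: if it cancels against \<open>c\<close>, then \<open>c\<close> is replaced by a cyclic
  rotation; otherwise the conjugate is already reduced and hence read from the basepoint.
\<close>

lemma conjugate_reads:
  assumes "c \<noteq> []" "reduced (c @ c)" "reduced x" "reduce (x @ c @ winv x) \<in> K"
  shows "\<exists>q. reads S (base S) x q \<and> reads S q c q"
  using assms
proof (induction x arbitrary: c rule: rev_induct)
  case Nil
  then have "reduced c" by (simp add: reduced_append)
  then show ?case using Nil reads_K[of c] base_verts by (simp add: reduce_reduced)
next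
  case (snoc y x)
  have rx: "reduced x" using snoc.prems by (simp add: reduced_append)
  consider (seam) "y \<noteq> linv (hd c)" "y \<noteq> last c" | (left) "y = linv (hd c)" | (right) "y = last c"
    by blast
  then show ?case
  proof cases
    case seam
    let ?x = "x @ [y]"
    have "reduced (winv ?x)" using snoc.prems(3) by (simp only: reduced_winv)
    moreover have "hd (winv ?x) = linv y" by simp
    ultimately have "reduced (c @ winv ?x)"
      using snoc.prems(2) seam(2) unfolding reduced_append[of c "winv ?x"] reduced_append[of c c]
      by auto
    then have "reduced (?x @ c @ winv ?x)"
      using snoc.prems(1,3) seam(1) unfolding reduced_append[of ?x "c @ winv ?x"] by auto
    then have "reads S (base S) (?x @ c @ winv ?x) (base S)"
      using snoc.prems reads_K by (simp add: reduce_reduced)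
    then obtain r s where "reads S (base S) ?x r" "reads S r c s" "reads S (base S) ?x s"
      unfolding reads_conj by blast
    with reads_det show ?thesis by metis
  next
    case left
    define a where "a = hd c"
    obtain t where c: "c = [a] @ t" using snoc.prems by (cases c) (auto simp: a_def)
    have y: "y = linv a" by (simp add: left a_def)
    have eq: "reduce ((x @ [linv a]) @ ([a] @ t) @ winv (x @ [linv a])) = reduce (x @ (t @ [a]) @ winv x)"
      using reduce_cancel(2)[of x "[a]" "t @ [a] @ winv x"] by simp
    have "reduce (x @ (t @ [a]) @ winv x) \<in> K"
      using snoc.prems(4) unfolding y c eq .
    moreover have "reduced ((t @ [a]) @ (t @ [a]))"
      using reduced_rotate snoc.prems(2) c by metis
    ultimately obtain q where q: "reads S (base S) x q" "reads S q (t @ [a]) q"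
      using snoc.IH[of "t @ [a]"] rx by blast
    then obtain s where s: "reads S q t s" "reads S s [a] q" by (auto simp only: reads_append_iff)
    then have "reads S q [linv a] s" using reads_winv_iff[of q "[a]" s] by simp
    \<comment> \<open>The rotated loop at \<open>q\<close> passes through \<open>s\<close>, and
      started there it reads \<open>c\<close>.\<close>
    then have "reads S (base S) (x @ [y]) s" "reads S s c s"
      using q(1) s by (auto simp only: reads_append_iff y c)
    then show ?thesis by blast
  next
    case right
    obtain t where c: "c = t @ [y]" using snoc.prems right by (cases c rule: rev_cases) auto
    have eq: "reduce ((x @ [y]) @ (t @ [y]) @ winv (x @ [y])) = reduce (x @ ([y] @ t) @ winv x)"
      using reduce_cancel(1)[of "x @ [y] @ t" "[y]" "winv x"] by simp
    have "reduce (x @ ([y] @ t) @ winv x) \<in> K"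
      using snoc.prems(4) unfolding c eq .
    moreover have "reduced (([y] @ t) @ ([y] @ t))"
      using reduced_rotate snoc.prems(2) c by metis
    ultimately obtain q where q: "reads S (base S) x q" "reads S q ([y] @ t) q"
      using snoc.IH[of "[y] @ t"] rx by blast
    then obtain s where s: "reads S q [y] s" "reads S s t q" by (auto simp only: reads_append_iff)
    then have "reads S (base S) (x @ [y]) s" "reads S s c s"
      using q(1) by (auto simp only: reads_append_iff c)
    then show ?thesis by blast
  qed
qed

section \<open>Malnormality as separation of loops\<close>

definition separated :: bool where
  "separated \<longleftrightarrow> (\<forall>u p q. u \<noteq> [] \<and> reduced u \<and> reads S p u p \<and> reads S q u q \<longrightarrow> p = q)"

lemma K_reduced_words: "K \<subseteq> reduced_words A"
  using subgroup.subset[OF subgroup_K] by simp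

lemma mem_K_iff: "w \<in> K \<longleftrightarrow> reduced w \<and> reads S (base S) w (base S)"
  using reads_K[of w] K_reads[of w] K_reduced_words by (auto simp: reduced_words_def reduce_reduced)

lemma mem_conjugate_iff:
  assumes "g \<in> reduced_words A"
  shows "h \<in> g <#\<^bsub>free_group A\<^esub> K #>\<^bsub>free_group A\<^esub> inv\<^bsub>free_group A\<^esub> g \<longleftrightarrow>
    (\<exists>k \<in> K. h = reduce (g @ k @ winv g))"
  using assms by (auto simp: l_coset_def r_coset_def inv_free_group)

lemma separated_imp_malnormal:
  assumes separated
  shows "malnormal (free_group A) K"
  unfolding malnormal_def
proof (intro conjI ballI equalityI subsetI subgroup_K)
  fix g h assume g: "g \<in> carrier (free_group A) - K"
    and h: "h \<in> (g <#\<^bsub>free_group A\<^esub> K #>\<^bsub>free_group A\<^esub> inv\<^bsub>free_group A\<^esub> g) \<inter> K"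
  from g have gr: "g \<in> reduced_words A" "reduced g" by (simp_all add: reduced_words_def)
  obtain k where k: "k \<in> K" "h = reduce (g @ k @ winv g)"
    using h by (auto simp: mem_conjugate_iff[OF gr(1)])
  have hK: "reduced h" "reads S (base S) h (base S)" using h by (simp_all add: mem_K_iff)
  have "h = []"
  proof (rule ccontr)
    assume "h \<noteq> []"
    then obtain v c where c: "h = v @ c @ winv v" "c \<noteq> []" "reduced (c @ c)"
      using cyclic_decomposition hK by blast
    \<comment> \<open>The conjugator is chosen so that conjugating \<open>c\<close> by it gives
      \<open>k\<close>, an element of K; \<open>conjugate_reads\<close> then yields a second loop
      labelled \<open>c\<close>.\<close>
    define x where "x = reduce (winv g @ v)"
    have "reduce (x @ c @ winv x) = reduce (winv g @ h @ g)"
      using reduce_reduce_mid(1)[of "winv g @ v @ c" "winv v @ g" "[]"]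
      by (simp add: x_def reduce_winv_reduce c(1))
    also have "\<dots> = reduce k"
      unfolding k(2) reduce_reduce_mid(1) append_assoc reduce_cancel(4)
      by simp
    also have "\<dots> = k" using k(1) by (simp add: mem_K_iff reduce_reduced)
    finally have "reduce (x @ c @ winv x) \<in> K" using k(1) by simp
    then obtain q where q: "reads S (base S) x q" "reads S q c q"
      using conjugate_reads[OF c(2,3)] reduced_reduce unfolding x_def by blast
    obtain p where p: "reads S (base S) v p" "reads S p c p"
      using hK(2) reads_det unfolding c(1) reads_conj by metis
    have "p = q"
      using assms c(2,3) p(2) q(2) unfolding separated_def reduced_append by blast
    \<comment> \<open>Now \<open>v\<close> and \<open>x\<close> lead from the basepoint to the same
      vertex, so the quotient, which reduces to \<open>g\<close>, is a loop there.\<close>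
    then have "reads S (base S) (v @ winv x) (base S)"
      using p(1) q(1) unfolding reads_append_iff reads_winv_iff by blast
    moreover have "reduce (v @ winv x) = g"
      using gr(2) by (simp add: x_def reduce_winv_reduce reduce_reduced)
    ultimately show False using K_reads g by auto
  qed
  then show "h \<in> {\<one>\<^bsub>free_group A\<^esub>}" by simp
next
  fix g h assume g: "g \<in> carrier (free_group A) - K" and "h \<in> {\<one>\<^bsub>free_group A\<^esub>}"
  then have g: "g \<in> reduced_words A" and h: "h = []" by simp_all
  have "[] \<in> K" using base_verts by (simp add: mem_K_iff)
  then show "h \<in> (g <#\<^bsub>free_group A\<^esub> K #>\<^bsub>free_group A\<^esub> inv\<^bsub>free_group A\<^esub> g) \<inter> K"
    unfolding Int_iff mem_conjugate_iff[OF g] h by force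
qed

lemma malnormal_imp_separated:
  assumes "malnormal (free_group A) K"
  shows separated
  unfolding separated_def
proof (intro allI impI, elim conjE)
  fix u p q assume u: "u \<noteq> []" "reduced u" "reads S p u p" "reads S q u q"
  obtain v where v: "reads S (base S) v p" using reachable reads_in_verts[OF u(3)] by blast
  obtain w where w: "reads S (base S) w q" using reachable reads_in_verts[OF u(4)] by blast
  \<comment> \<open>Conjugation by \<open>g\<close> carries the element
    \<open>w @ u @ winv w\<close> of K to \<open>v @ u @ winv v\<close>, also in K.\<close>
  define g where "g = reduce (v @ winv w)"
  have loop: "reduce (t @ u @ winv t) \<in> K" if "reads S (base S) t s" "reads S s u s" for t s
    using that K_reads reads_conj by blast
  have g: "g \<in> reduced_words A"
    using reads_letters[OF v] reads_letters[OF w] letters_reduce[of "v @ winv w" A]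
    by (simp add: g_def reduced_words_def reduced_reduce)
  have "g \<in> K"
  proof (rule ccontr)
    assume "g \<notin> K"
    define h where "h = reduce (v @ u @ winv v)"
    have "h = reduce (g @ reduce (w @ u @ winv w) @ winv g)"
      using reduce_reduce_mid(3)[of "v @ u @ winv w" "w @ winv v"] reduce_cancel(2)[of "v @ u" w "winv v"]
      by (simp add: g_def h_def reduce_winv_reduce)
    then have "h \<in> (g <#\<^bsub>free_group A\<^esub> K #>\<^bsub>free_group A\<^esub> inv\<^bsub>free_group A\<^esub> g) \<inter> K"
      unfolding Int_iff mem_conjugate_iff[OF g] using loop[OF v u(3)] loop[OF w u(4)]
      by (intro conjI bexI) (assumption, simp_all only: h_def)
    then have "h = []" using assms g \<open>g \<notin> K\<close> unfolding malnormal_def by auto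
    then show False using conjugate_eq_NilD u(1,2) unfolding h_def by blast
  qed
  \<comment> \<open>As an element of K, \<open>g\<close> is a loop at the basepoint, so
    \<open>g @ w\<close> ends at \<open>q\<close>; but it represents the same element as
    \<open>v\<close>, which ends at \<open>p\<close>.\<close>
  then have "reads S (base S) (g @ w) q" using w reads_K reads_append_iff by blast
  then have "reads S (base S) (reduce (g @ w)) q" by (rule reads_reduced)
  moreover have "reduce (g @ w) = reduce v" by (simp add: g_def)
  ultimately show "p = q" using reads_reduced[OF v] reads_det by simp
qed

section \<open>Idempotents induced by reduced words\<close>

text \<open>Idempotency is demanded of the core \<open>c\<close>, so that it survives when letters
  of the conjugator \<open>v\<close> are stripped.\<close>

definition good_word :: "'a letter list \<Rightarrow> bool" where
  "good_word u \<longleftrightarrow> reduced u \<and>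
     (\<exists>v c. u = v @ c @ winv v \<and> c \<noteq> [] \<and> reduced (c @ c) \<and> idem c)"

lemma good_word_idem: "good_word u \<Longrightarrow> u \<noteq> [] \<and> reduced u \<and> idem u"
  unfolding good_word_def idem_def using reads_conj reads_inj by (fastforce simp: reads_conj)

text \<open>Replace the cyclically reduced core by an idempotent power. Its end letters do not
  change, so the conjugate stays reduced, and loops of the core remain loops of its powers.\<close>

lemma ex_good_word:
  assumes "reduced u" "u \<noteq> []"
  shows "\<exists>w. good_word w \<and> (\<forall>p. reads S p u p \<longrightarrow> reads S p w p)"
proof -
  obtain v c where u: "u = v @ c @ winv v" "c \<noteq> []" "reduced (c @ c)"
    using cyclic_decomposition[OF assms] by blast
  obtain n where n: "n > 0" "idem (wpow c n)" using ex_idem_power by blast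
  note pow = reduced_wpow[OF u(3,2)]
  have "reduced (wpow c n @ wpow c n)" using pow[of "n + n"] by (simp only: wpow_add)
  moreover have "reduced (v @ wpow c n @ winv v)"
    using assms(1) pow[of n] n(1) by (auto simp: u(1) u(2) reduced_append)
  ultimately have "good_word (v @ wpow c n @ winv v)"
    unfolding good_word_def using pow[of n] n by blast
  moreover have "reads S p (v @ wpow c n @ winv v) p" if p: "reads S p u p" for p
  proof -
    obtain r where r: "reads S p v r" "reads S r c r"
      using p reads_det unfolding u(1) reads_conj by metis
    have "reads S r (wpow c n) r"
      by (induction n) (use r reads_in_verts reads_append_iff in auto)
    with r(1) show ?thesis unfolding reads_conj by blast
  qed
  ultimately show ?thesis by blast
qed

text \<open>The conjugator is nonempty, since a cyclically reduced word cannot have mutually inverse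
  end letters.\<close>

lemma good_word_strip:
  assumes "good_word u" "hd u = linv (last u)"
  shows "\<exists>u'. u = hd u # u' @ [linv (hd u)] \<and> good_word u'"
proof -
  obtain v c where u: "u = v @ c @ winv v" "c \<noteq> []" "reduced (c @ c)" "idem c" "reduced u"
    using assms(1) unfolding good_word_def by blast
  show ?thesis
  proof (cases v)
    case Nil
    then show ?thesis using u(2,3) assms(2) by (simp add: u(1) reduced_append)
  next
    case (Cons a v')
    have "reduced (a # (v' @ c @ winv v') @ [linv a])" using u(5) by (simp add: u(1) Cons)
    then have "reduced (v' @ c @ winv v')"
      unfolding reduced_Cons[of a] reduced_append[of "v' @ c @ winv v'"] by blast
    then have "good_word (v' @ c @ winv v')" unfolding good_word_def using u by blast
    then show ?thesis by (intro exI[of _ "v' @ c @ winv v'"]) (simp add: u(1) Cons)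
  qed
qed

text \<open>
  The meet of two such idempotents is induced by a single reduced word: peel off the common
  conjugating prefix until one of the products \<open>u\<^sup>\<plusminus>w\<^sup>\<plusminus>\<close> is reduced.
\<close>

lemma good_word_meet:
  assumes "good_word u" "good_word w" "reads S q u q" "reads S q w q"
  shows "\<exists>z. z \<noteq> [] \<and> reduced z \<and> idem z \<and> reads S q z q \<and>
    (\<forall>p. reads S p z p \<longrightarrow> reads S p u p \<and> reads S p w p) \<and>
    {hd z, linv (last z)} \<subseteq> {hd u, linv (last u), hd w, linv (last w)}"
  using assms
proof (induction "length u" arbitrary: u w q rule: less_induct)
  case less
  note u = good_word_idem[OF less.prems(1)] and w = good_word_idem[OF less.prems(2)]
  show ?case
  proof (cases "\<exists>u' \<in> {u, winv u}. \<exists>w' \<in> {w, winv w}. reduced (u' @ w')")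
    case True
    then obtain u' w' where uw: "u' \<in> {u, winv u}" "w' \<in> {w, winv w}" "reduced (u' @ w')" by blast
    \<comment> \<open>Inverting a word that acts as a partial identity does not change its
      action.\<close>
    have ru: "reads S p u' p' \<longleftrightarrow> p = p' \<and> reads S p u p" for p p'
      using u uw(1) reads_winv_iff[of p u p'] unfolding idem_def by auto
    have rw: "reads S p w' p' \<longleftrightarrow> p = p' \<and> reads S p w p" for p p'
      using w uw(2) reads_winv_iff[of p w p'] unfolding idem_def by auto
    have "u' \<noteq> []" "w' \<noteq> []" using u w uw(1,2) by (metis empty_iff insert_iff winv_eq_Nil)+
    then have "{hd (u' @ w'), linv (last (u' @ w'))} \<subseteq> {hd u, linv (last u), hd w, linv (last w)}"
      using u w uw(1,2) by (auto simp: hd_winv last_winv)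
    moreover have "idem (u' @ w')" unfolding idem_def reads_append_iff ru rw by blast
    ultimately show ?thesis
      using \<open>u' \<noteq> []\<close> uw(3) less.prems(3,4)
      by (intro exI[of _ "u' @ w'"] conjI) (auto simp only: reads_append_iff ru rw append_is_Nil_conv)
  next
    case False
    define a where "a = hd u"
    \<comment> \<open>If all four products cancel at the seam, both words begin with the same letter
      \<open>a\<close> and end with its inverse.\<close>
    have ends: "hd w = a" "hd u = linv (last u)" "hd w = linv (last w)"
      using False u w by (auto simp: reduced_append hd_winv last_winv a_def)
    obtain u' where u': "u = a # u' @ [linv a]" "good_word u'"
      using good_word_strip[OF less.prems(1) ends(2)] by (auto simp: a_def)
    obtain w' where w': "w = a # w' @ [linv a]" "good_word w'"
      using good_word_strip[OF less.prems(2) ends(3)] by (auto simp: ends(1))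
    have conj: "reads S p (a # t @ [linv a]) p' \<longleftrightarrow>
        (\<exists>r s. (p, a, r) \<in> edges S \<and> reads S r t s \<and> (p', a, s) \<in> edges S)" for p t p'
      using reads_conj[of p "[a]" t p'] unfolding reads_single by simp
    obtain q' where q': "(q, a, q') \<in> edges S" "reads S q' u' q'" "reads S q' w' q'"
      using less.prems(3,4) edges_det unfolding u'(1) w'(1) conj by metis
    obtain z where z: "z \<noteq> []" "reduced z" "idem z" "reads S q' z q'"
      "\<And>p. reads S p z p \<Longrightarrow> reads S p u' p \<and> reads S p w' p"
      "{hd z, linv (last z)} \<subseteq> {hd u', linv (last u'), hd w', linv (last w')}"
      using less.hyps[OF _ u'(2) w'(2) q'(2,3)] u'(1) by auto
    \<comment> \<open>Here the clause on end letters pays off: since \<open>u\<close> and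
      \<open>w\<close> are reduced, wrapping \<open>a\<close> around \<open>z\<close> creates no
      cancellation.\<close>
    have "linv a \<notin> {hd u', linv (last u'), hd w', linv (last w')}"
      using u w good_word_idem[OF u'(2)] good_word_idem[OF w'(2)] unfolding u'(1) w'(1)
      by (auto simp: reduced_Cons reduced_append)
    then have "linv a \<noteq> hd z" "linv a \<noteq> linv (last z)" using z(6) by auto
    then have "reduced (a # z @ [linv a])"
      using z(1,2) by (auto simp: reduced_Cons reduced_append)
    moreover have "idem (a # z @ [linv a])"
      unfolding idem_def conj
    proof (intro allI impI, elim exE conjE)
      fix p p' r s assume e: "(p, a, r) \<in> edges S" "reads S r z s" "(p', a, s) \<in> edges S"
      then have "r = s" using z(3) by (auto simp: idem_def)
      with e show "p = p'" using reads_inj[of p "[a]" r p'] by (simp only: reads_single)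
    qed
    moreover have "reads S p u p \<and> reads S p w p" if "reads S p (a # z @ [linv a]) p" for p
      using that z(5) edges_det unfolding u'(1) w'(1) conj by metis
    moreover have "reads S q (a # z @ [linv a]) q" using q'(1) z(4) unfolding conj by blast
    ultimately show ?thesis
      by (intro exI[of _ "a # z @ [linv a]"]) (auto simp: a_def)
  qed
qed

section \<open>Complete automata and words with empty domain\<close>

definition complete :: bool where
  "complete \<longleftrightarrow> (\<forall>p \<in> verts S. \<forall>x \<in> letters A. \<exists>q. (p, x, q) \<in> edges S)"

definition word_dom :: "'a letter list \<Rightarrow> 'q set" where
  "word_dom w = {p. \<exists>q. reads S p w q}"

lemma word_dom_subset: "word_dom w \<subseteq> verts S"
  using reads_in_verts by (auto simp: word_dom_def)

lemma finite_word_dom [simp]: "finite (word_dom w)"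
  using finite_subset[OF word_dom_subset finite_verts] .

lemma complete_reads:
  assumes complete
  shows "w \<in> lists (letters A) \<Longrightarrow> p \<in> verts S \<Longrightarrow> \<exists>q. reads S p w q"
proof (induction w arbitrary: p)
  case (Cons x w)
  then obtain s where "(p, x, s) \<in> edges S" using assms unfolding complete_def Cons_in_lists_iff by blast
  then show ?case using Cons edges_wf by fastforce
qed auto

text \<open>
  If a reduced word \<open>u\<close> with minimal nonempty domain is defined at \<open>p\<close>, then all its reduced
  extensions are, and the endpoints of the latter form a complete, hence full, subautomaton.
\<close>

lemma complete_or_empty:
  assumes "letters A \<noteq> {}"
  shows "complete \<or> (\<exists>w \<in> reduced_words A - {[]}. word_dom w = {})"
proof (rule disjCI)
  assume ne: "\<not> (\<exists>w \<in> reduced_words A - {[]}. word_dom w = {})"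
  obtain x0 where "x0 \<in> letters A" using assms by blast
  then have "[x0] \<in> reduced_words A - {[]}" by (simp add: reduced_words_def reduced_Cons)
  then obtain u where u: "u \<in> reduced_words A - {[]}"
    and min: "\<And>w. w \<in> reduced_words A - {[]} \<Longrightarrow> card (word_dom u) \<le> card (word_dom w)"
    using ex_has_least_nat[of "\<lambda>w. w \<in> reduced_words A - {[]}" "[x0]" "\<lambda>w. card (word_dom w)"] by blast
  obtain p where p: "p \<in> word_dom u" using ne u by blast
  have ext: "\<exists>q. reads S p (u @ z) q" if "u @ z \<in> reduced_words A" for z
  proof -
    have "word_dom (u @ z) \<subseteq> word_dom u" by (auto simp: word_dom_def reads_append_iff)
    moreover have "card (word_dom u) \<le> card (word_dom (u @ z))" using min[of "u @ z"] that u by simp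
    ultimately have "word_dom (u @ z) = word_dom u" by (simp add: card_seteq)
    with p show ?thesis by (auto simp: word_dom_def)
  qed
  define P where "P = {q. \<exists>z. u @ z \<in> reduced_words A \<and> reads S p (u @ z) q}"
  have closed: "\<exists>q' \<in> P. (q, y, q') \<in> edges S" if q: "q \<in> P" and y: "y \<in> letters A" for q y
  proof -
    obtain z where z: "u @ z \<in> reduced_words A" "reads S p (u @ z) q" using q by (auto simp: P_def)
    define x where "x = last (u @ z)"
    have uz: "u @ z \<noteq> []" using u by simp
    then have x: "x \<in> letters A" using z(1) last_in_set[OF uz] unfolding x_def reduced_words_def
      by (auto simp del: last_append)
    show ?thesis
    proof (cases "y = linv x")
      case False
      then have r: "u @ (z @ [y]) \<in> reduced_words A"
        using z(1) y reduced_append[of "u @ z" "[y]"] by (simp add: reduced_words_def x_def reduced_Cons)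
      then obtain q' where q': "reads S p (u @ (z @ [y])) q'" using ext by blast
      then have "reads S p ((u @ z) @ [y]) q'" by simp
      then have "reads S q [y] q'" using z(2) reads_det unfolding reads_append_iff[of p "u @ z"] by metis
      then show ?thesis using r q' by (auto simp: P_def reads_single simp del: reads.simps)
    next
      case True
      \<comment> \<open>The letter \<open>y\<close> would cancel, so it cannot be appended. Instead,
        \<open>q\<close> is fixed by a readable power of \<open>x\<close> and hence lies on an
        \<open>x\<close>-cycle; its predecessor there is the target of the
        \<open>y\<close>-edge.\<close>
      obtain n where n: "n > 0" "idem (wpow [x] n)" using ex_idem_power by blast
      then obtain m where m: "n = m + 1" by (metis Suc_eq_plus1 Suc_pred')
      have pow: "u @ (z @ wpow [x] i) \<in> reduced_words A" for i
      proof -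
        have "reduced (wpow [x] i)" "wpow [x] i = [] \<or> hd (wpow [x] i) = x"
          using reduced_wpow[of "[x]" i] by (cases i; auto simp: reduced_Cons)+
        then have "reduced ((u @ z) @ wpow [x] i)"
          unfolding reduced_append[of "u @ z"] using z(1) uz x_def by (auto simp: reduced_words_def)
        moreover have "wpow [x] i \<in> lists (letters A)" using x by (induction i) auto
        ultimately show ?thesis using z(1) by (simp add: reduced_words_def)
      qed
      obtain q2 where "reads S p (u @ (z @ wpow [x] n)) q2" using ext[OF pow] by blast
      then have "reads S p ((u @ z) @ wpow [x] n) q2" by simp
      then have q2: "reads S q (wpow [x] n) q2" using z(2) reads_det unfolding reads_append_iff[of p "u @ z"] by metis
      then have "q2 = q" using n(2) by (auto simp: idem_def)
      with q2 have "reads S q (wpow [x] m @ [x]) q" unfolding m wpow_add by simp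
      then obtain q' where q': "reads S q (wpow [x] m) q'" "reads S q' [x] q" unfolding reads_append_iff by blast
      have "reads S p ((u @ z) @ wpow [x] m) q'" using z(2) q'(1) unfolding reads_append_iff[of p "u @ z"] by blast
      then have "q' \<in> P" using pow[of m] unfolding P_def append_assoc by blast
      moreover have "(q, y, q') \<in> edges S"
        using q'(2) edges_inv unfolding True reads_single by blast
      ultimately show ?thesis by blast
    qed
  qed
  have reads_P: "q' \<in> P" if "reads S q w q'" "q \<in> P" for q w q'
    using that
  proof (induction w arbitrary: q)
    case (Cons x w)
    then obtain s where s: "(q, x, s) \<in> edges S" "reads S s w q'" by auto
    then have "x \<in> letters A" using edges_wf by auto
    then have "s \<in> P" using closed[OF Cons.prems(2)] edges_det s(1) by metis
    then show ?case using Cons.IH s(2) by blast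
  qed simp
  have u0: "u @ [] \<in> reduced_words A" using u by simp
  obtain q0 where "reads S p (u @ []) q0" using ext[OF u0] by blast
  then have "q0 \<in> P" unfolding P_def using u0 by blast
  moreover have "P \<subseteq> verts S" using reads_in_verts by (auto simp: P_def)
  ultimately obtain w where "reads S (base S) w q0" using reachable by blast
  then have "reads S q0 (winv w) (base S)" by (simp add: reads_winv_iff)
  then have "base S \<in> P" using reads_P \<open>q0 \<in> P\<close> by blast
  then have "verts S \<subseteq> P" using reachable reads_P by blast
  then show complete using closed unfolding complete_def by blast
qed

text \<open>An idempotent power of a letter is a loop at every vertex of a complete automaton.
  Separation then leaves a single vertex, at which all reduced words are loops.\<close>

lemma complete_separated:
  assumes complete separated "letters A \<noteq> {}"
  shows "K = reduced_words A"
proof (intro equalityI K_reduced_words subsetI)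
  fix w assume w: "w \<in> reduced_words A"
  obtain x where x: "x \<in> letters A" using assms(3) by blast
  obtain n where n: "n > 0" "idem (wpow [x] n)" using ex_idem_power by blast
  have "wpow [x] n \<in> lists (letters A)" using x by (induction n) auto
  then have loop: "reads S p (wpow [x] n) p" if "p \<in> verts S" for p
    using complete_reads[OF assms(1) _ that] n(2) by (metis idem_def)
  have "reduced (wpow [x] n) \<and> wpow [x] n \<noteq> []"
    using reduced_wpow[of "[x]" n] n(1) by (simp add: reduced_Cons)
  then have one: "p = q" if "p \<in> verts S" "q \<in> verts S" for p q
    using assms(2) loop that unfolding separated_def by blast
  obtain q where "reads S (base S) w q"
    using complete_reads[OF assms(1) _ base_verts] w by (auto simp: reduced_words_def)
  moreover have "q = base S" using one reads_in_verts[OF calculation] base_verts by blast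
  ultimately show "w \<in> K" using w by (simp add: mem_K_iff reduced_words_def)
qed

section \<open>The family of domains of idempotents\<close>

text \<open>A set-theoretic model of E: partial identities are determined by their domains, and the
  natural order becomes inclusion.\<close>

definition idem_domains :: "'q set set" where
  "idem_domains = {word_dom w | w. w \<in> reduced_words A - {[]} \<and> idem w}"

lemma idem_domains_subset: "idem_domains \<subseteq> Pow (verts S)"
  using word_dom_subset by (auto simp: idem_domains_def)

lemma mem_word_dom_idem: "idem w \<Longrightarrow> p \<in> word_dom w \<longleftrightarrow> reads S p w p"
  by (auto simp: word_dom_def idem_def)

lemma idem_domainsI:
  assumes "z \<noteq> []" "reduced z" "idem z" "reads S q z q"
  shows "word_dom z \<in> idem_domains" "q \<in> word_dom z"
  using assms reads_letters[OF assms(4)] by (auto simp: idem_domains_def reduced_words_def mem_word_dom_idem)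

text \<open>Conjugate a nontrivial element of K by a path to \<open>q\<close>; the result is a
  nontrivial loop at \<open>q\<close>, to which \<open>ex_good_word\<close> applies.\<close>

lemma ex_idem_domain:
  assumes "K \<noteq> {[]}" "q \<in> verts S"
  shows "\<exists>D \<in> idem_domains. q \<in> D"
proof -
  have "[] \<in> K" using base_verts by (simp add: mem_K_iff)
  then obtain h where h: "h \<in> K" "h \<noteq> []" using assms(1) by blast
  obtain v where v: "reads S (base S) v q" using reachable assms(2) by blast
  have hK: "reduced h" "reads S (base S) h (base S)" using h(1) by (simp_all add: mem_K_iff)
  define u where "u = reduce (winv v @ h @ v)"
  have "u \<noteq> []" using conjugate_eq_NilD[of "winv v" h] h(2) hK(1) by (auto simp: u_def)
  moreover have "reads S q (winv v @ h @ v) q" using hK(2) v by (auto simp: reads_append_iff reads_winv_iff)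
  then have "reads S q u q" unfolding u_def by (rule reads_reduced)
  ultimately obtain w where w: "good_word w" "reads S q w q"
    using ex_good_word[of u] by (auto simp: u_def reduced_reduce)
  then show ?thesis using good_word_idem[OF w(1)] idem_domainsI[of w q] by blast
qed

text \<open>Separation bounds domains by one point and \<open>ex_idem_domain\<close> reaches every
  vertex. The empty domain occurs because K is proper, so that \<open>complete_separated\<close>
  rules out completeness.\<close>

lemma separated_idem_domains:
  assumes "separated" "K \<noteq> {[]}" "K \<noteq> reduced_words A"
  shows "idem_domains = insert {} ((\<lambda>q. {q}) ` verts S)"
proof (intro equalityI subsetI)
  have single: "p = q" if "D \<in> idem_domains" "p \<in> D" "q \<in> D" for D p q
    using that assms(1) unfolding idem_domains_def separated_def reduced_words_def
    by (auto simp: mem_word_dom_idem)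
  { fix D assume D: "D \<in> idem_domains"
    show "D \<in> insert {} ((\<lambda>q. {q}) ` verts S)"
    proof (cases "D = {}")
      case False
      then obtain q where "q \<in> D" by blast
      then show ?thesis using single[OF D] idem_domains_subset D by blast
    qed simp }
  have "letters A \<noteq> {}"
  proof
    assume "letters A = {}"
    then have "reduced_words A = {[]}" by (auto simp: reduced_words_def)
    then show False using K_reduced_words assms(2) base_verts mem_K_iff[of "[]"] by auto
  qed
  then obtain w where "w \<in> reduced_words A - {[]}" "word_dom w = {}"
    using complete_or_empty complete_separated assms by blast
  then have e: "{} \<in> idem_domains" unfolding idem_domains_def idem_def word_dom_def by blast
  fix D assume "D \<in> insert {} ((\<lambda>q. {q}) ` verts S)"
  then consider "D = {}" | q where "q \<in> verts S" "D = {q}" by blast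
  then show "D \<in> idem_domains"
  proof cases
    case 2
    obtain D' where D': "D' \<in> idem_domains" "q \<in> D'" using ex_idem_domain assms(2) 2 by blast
    then have "D' = {q}" using single by blast
    with D' 2 show ?thesis by simp
  qed (use e in simp)
qed

text \<open>By \<open>good_word_meet\<close>, two domains sharing \<open>q\<close> both contain a
  third one through \<open>q\<close>; incomparability of nonempty domains makes all three
  equal.\<close>

lemma disjoint_idem_domains:
  assumes "\<And>D D'. D \<in> idem_domains \<Longrightarrow> D' \<in> idem_domains \<Longrightarrow> D \<noteq> {} \<Longrightarrow> D \<subseteq> D' \<Longrightarrow> D = D'"
    and D: "D \<in> idem_domains" "D' \<in> idem_domains" "q \<in> D" "q \<in> D'"
  shows "D = D'"
proof -
  \<comment> \<open>Passing from \<open>u\<close> to a good word can only enlarge the domain, so by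
    incomparability it stays the same.\<close>
  have good: "\<exists>u. good_word u \<and> word_dom u = D \<and> reads S q u q" if D: "D \<in> idem_domains" "q \<in> D" for D
  proof -
    obtain u where u: "D = word_dom u" "u \<noteq> []" "reduced u" "idem u"
      using D(1) by (auto simp: idem_domains_def reduced_words_def)
    have q: "reads S q u q" using D(2) u by (simp add: mem_word_dom_idem)
    obtain w where w: "good_word w" "\<And>p. reads S p u p \<Longrightarrow> reads S p w p"
      using ex_good_word[OF u(3,2)] by blast
    note wi = good_word_idem[OF w(1)]
    have "word_dom w \<in> idem_domains" using idem_domainsI wi w(2)[OF q] by blast
    moreover have "D \<subseteq> word_dom w" using w(2) wi u(4) by (auto simp: u(1) mem_word_dom_idem)
    ultimately have "D = word_dom w" using assms(1) D by blast
    with w q show ?thesis by blast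
  qed
  obtain u where u: "good_word u" "word_dom u = D" "reads S q u q" using good D by blast
  obtain w where w: "good_word w" "word_dom w = D'" "reads S q w q" using good D by blast
  obtain z where z: "z \<noteq> []" "reduced z" "idem z" "reads S q z q"
      "\<And>p. reads S p z p \<Longrightarrow> reads S p u p \<and> reads S p w p"
    using good_word_meet[OF u(1) w(1) u(3) w(3)] by blast
  note zD = idem_domainsI[OF z(1-4)]
  have "word_dom z \<subseteq> D" "word_dom z \<subseteq> D'"
    using z(3,5) good_word_idem[OF u(1)] good_word_idem[OF w(1)]
    by (auto simp: u(2)[symmetric] w(2)[symmetric] mem_word_dom_idem)
  then show ?thesis using assms(1)[OF zD(1) D(1)] assms(1)[OF zD(1) D(2)] zD(2) by blast
qed

text \<open>Incomparability is assumed only once the empty domain is present, because it will come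
  from excluding chains of three elements with that domain at the bottom.\<close>

lemma idem_domains_imp_separated:
  assumes "K \<noteq> {[]}" and card: "card idem_domains = card (verts S) + 1"
    and anti: "\<And>D D'. {} \<in> idem_domains \<Longrightarrow> D \<in> idem_domains \<Longrightarrow> D' \<in> idem_domains \<Longrightarrow> D \<noteq> {} \<Longrightarrow>
      D \<subseteq> D' \<Longrightarrow> D = D'"
  shows separated
proof -
  have "letters A \<noteq> {}"
  proof
    assume "letters A = {}"
    then have "reduced_words A = {[]}" by (auto simp: reduced_words_def)
    then show False using K_reduced_words assms(1) base_verts mem_K_iff[of "[]"] by auto
  qed
  \<comment> \<open>In a complete automaton \<open>verts S\<close> is the only possible domain,
    whereas the cardinality assumption requires at least two.\<close>
  moreover have "\<not> complete"
  proof
    assume complete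
    have "verts S \<subseteq> word_dom w" if "w \<in> reduced_words A" for w
      using complete_reads[OF \<open>complete\<close>] that by (auto simp: word_dom_def reduced_words_def)
    then have "word_dom w = verts S" if "w \<in> reduced_words A" for w
      using that word_dom_subset by (metis subset_antisym)
    then have "idem_domains \<subseteq> {verts S}" by (auto simp: idem_domains_def)
    then have "card idem_domains \<le> 1" using card_mono[of "{verts S}"] by fastforce
    then show False using card base_verts finite_verts by auto
  qed
  ultimately obtain w where "w \<in> reduced_words A - {[]}" "word_dom w = {}"
    using complete_or_empty by blast
  then have e: "{} \<in> idem_domains" unfolding idem_domains_def idem_def word_dom_def by blast
  have disj: "D = D'" if "D \<in> idem_domains" "D' \<in> idem_domains" "q \<in> D" "q \<in> D'" for D D' q
    by (rule disjoint_idem_domains[OF _ that]) (rule anti[OF e])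
  \<comment> \<open>Choosing a vertex in each nonempty domain is injective by disjointness, hence
    surjective by counting. So any vertex of a domain is its representative, and nonempty domains
    are singletons.\<close>
  define rep where "rep D = (SOME q :: 'q. q \<in> D)" for D
  have rep: "rep D \<in> D" if "D \<in> idem_domains - {{}}" for D
    using that by (simp add: rep_def some_in_eq)
  have fin: "finite idem_domains"
    using idem_domains_subset finite_verts by (meson finite_Pow_iff finite_subset)
  have "inj_on rep (idem_domains - {{}})"
    by (rule inj_onI) (metis DiffD1 disj rep)
  then have "card (rep ` (idem_domains - {{}})) = card (verts S)"
    using card fin e by (simp add: card_image)
  moreover have "rep ` (idem_domains - {{}}) \<subseteq> verts S" using rep idem_domains_subset by blast
  ultimately have surj: "rep ` (idem_domains - {{}}) = verts S"
    using finite_verts card_subset_eq by blast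
  have is_rep: "q = rep D" if D: "D \<in> idem_domains" "q \<in> D" for q D
  proof -
    have "q \<in> verts S" using D idem_domains_subset by blast
    then obtain D' where D': "D' \<in> idem_domains - {{}}" "q = rep D'" using surj by blast
    then have "D' = D" using disj[of D' D q] rep[OF D'(1)] D by blast
    with D' show ?thesis by simp
  qed
  show ?thesis unfolding separated_def
  proof (intro allI impI, elim conjE)
    fix u p q assume u: "u \<noteq> []" "reduced u" "reads S p u p" "reads S q u q"
    then obtain w where w: "good_word w" "reads S p w p" "reads S q w q"
      using ex_good_word by blast
    note idem_domainsI[of w, OF good_word_idem[OF w(1), THEN conjunct1]
        good_word_idem[OF w(1), THEN conjunct2, THEN conjunct1]
        good_word_idem[OF w(1), THEN conjunct2, THEN conjunct2]]
    then show "p = q" using is_rep[of "word_dom w" p] is_rep[of "word_dom w" q] w(2,3) by simp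
  qed
qed

section \<open>Chains of idempotents\<close>

definition partial_id :: "'q set \<Rightarrow> 'q \<rightharpoonup> 'q" where
  "partial_id D = (\<lambda>p. if p \<in> D then Some p else None)"

lemma partial_id_inject: "partial_id D = partial_id D' \<longleftrightarrow> D = D'"
  unfolding partial_id_def by (metis (mono_tags) option.distinct(1) subsetI subset_antisym)

lemma step_eq_Some: "step S x p = Some q \<longleftrightarrow> (p, x, q) \<in> edges S"
proof -
  have "(THE q. (p, x, q) \<in> edges S) = r" if "(p, x, r) \<in> edges S" for r
    using that edges_det by blast
  then show ?thesis by (auto simp: step_def)
qed

lemma delta_eq_Some: "delta S w p = Some q \<longleftrightarrow> reads S p w q"
  by (induction w arbitrary: p) (auto simp: map_comp_Some_iff step_eq_Some)

lemma delta_idem_iff: "delta S w \<circ>\<^sub>m delta S w = delta S w \<longleftrightarrow> idem w"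
proof
  assume *: "delta S w \<circ>\<^sub>m delta S w = delta S w"
  show "idem w" unfolding idem_def
  proof (intro allI impI)
    fix p q assume pq: "reads S p w q"
    then have "(delta S w \<circ>\<^sub>m delta S w) p = Some q" by (simp add: * delta_eq_Some)
    then obtain s where "reads S p w s" "reads S s w q"
      by (auto simp: map_comp_Some_iff delta_eq_Some)
    with pq reads_det reads_inj show "p = q" by metis
  qed
next
  assume "idem w"
  then show "delta S w \<circ>\<^sub>m delta S w = delta S w"
    by (intro ext option.expand) (auto simp: map_comp_def idem_def delta_eq_Some split: option.splits)
qed

lemma delta_idem: "idem w \<Longrightarrow> delta S w = partial_id (word_dom w)"
proof
  fix p assume "idem w"
  then show "delta S w p = partial_id (word_dom w) p"
    by (cases "delta S w p") (auto simp: partial_id_def word_dom_def idem_def delta_eq_Some[symmetric])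
qed

lemma idempotents_eq:
  "{delta S u | u. u \<in> reduced_words A - {[]} \<and>
     delta S u \<otimes>\<^bsub>transition_monoid A S\<^esub> delta S u = delta S u} = partial_id ` idem_domains"
  by (auto simp: transition_monoid_def delta_idem_iff idem_domains_def delta_idem)
    (metis delta_idem)

text \<open>If the inclusion holds, \<open>partial_id D\<close> itself is the required idempotent;
  it belongs to the monoid because \<open>D\<close> is the domain of an idempotent word.\<close>

lemma natural_le_partial_id:
  assumes D: "D \<in> idem_domains"
  shows "natural_le (transition_monoid A S) (partial_id D) (partial_id D') \<longleftrightarrow> D \<subseteq> D'"
proof
  assume "natural_le (transition_monoid A S) (partial_id D) (partial_id D')"
  then obtain w where w: "partial_id D = partial_id D' \<circ>\<^sub>m delta S w"
    by (auto simp: natural_le_def transition_monoid_def)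
  show "D \<subseteq> D'"
  proof
    fix p assume "p \<in> D"
    then have "(partial_id D' \<circ>\<^sub>m delta S w) p = Some p" unfolding w[symmetric] by (simp add: partial_id_def)
    then show "p \<in> D'" by (auto simp: map_comp_Some_iff partial_id_def split: if_splits)
  qed
next
  assume sub: "D \<subseteq> D'"
  obtain w where w: "w \<in> lists (letters A)" "idem w" "D = word_dom w"
    using D by (auto simp: idem_domains_def reduced_words_def)
  then have d: "delta S w = partial_id D" by (simp add: delta_idem)
  have "delta S w \<in> carrier (transition_monoid A S)"
    using w(1) unfolding transition_monoid_def by auto
  then have "partial_id D \<in> carrier (transition_monoid A S)" by (simp only: d)
  moreover have "partial_id D \<circ>\<^sub>m partial_id D = partial_id D" using delta_idem_iff w(2) d by metis
  moreover have "partial_id D = partial_id D' \<circ>\<^sub>m partial_id D" using sub by (intro ext) (auto simp: partial_id_def map_comp_def)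
  ultimately show "natural_le (transition_monoid A S) (partial_id D) (partial_id D')"
    unfolding natural_le_def by (intro bexI[of _ "partial_id D"]) (simp_all add: transition_monoid_def)
qed

lemma malnormal_iff:
  assumes "K \<noteq> {[]}" "K \<noteq> reduced_words A"
    and E: "E = partial_id ` idem_domains"
    and k: "k = Max (card ` {C. fin_chain_in (natural_le (transition_monoid A S)) E C})"
  shows "malnormal (free_group A) K \<longleftrightarrow> k = 2 \<and> card E = card (verts S) + 1"
proof -
  let ?le = "natural_le (transition_monoid A S)"
  let ?CH = "{C. fin_chain_in ?le E C}"
  have fin: "finite idem_domains"
    using idem_domains_subset finite_verts by (meson finite_Pow_iff finite_subset)
  have "?CH \<subseteq> Pow E" by (auto simp: fin_chain_in_def)
  then have finCH: "finite (card ` ?CH)" using fin E by (simp add: finite_subset)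
  have cardE: "card E = card idem_domains"
    unfolding E by (rule card_image) (simp add: inj_on_def partial_id_inject)
  show ?thesis
  proof
    assume "malnormal (free_group A) K"
    then have "separated" by (rule malnormal_imp_separated)
    note D = separated_idem_domains[OF this assms(1,2)]
    have "card idem_domains = card (verts S) + 1"
      unfolding D using finite_verts by (subst card_insert_disjoint) (auto simp: card_image inj_on_def)
    moreover have "Max (card ` ?CH) = 2"
    proof (rule Max_eqI[OF finCH])
      fix n assume "n \<in> card ` ?CH"
      then obtain C where C: "n = card C" "C \<subseteq> E" "finite C" "\<And>x y. x \<in> C \<Longrightarrow> y \<in> C \<Longrightarrow> ?le x y \<or> ?le y x"
        by (auto simp: fin_chain_in_def)
      \<comment> \<open>Apart from the bottom element, a chain can contain only one singleton, since
        distinct singletons are incomparable.\<close>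
      have "x = y" if xy: "x \<in> C - {partial_id {}}" "y \<in> C - {partial_id {}}" for x y
      proof -
        obtain p where p: "p \<in> verts S" "x = partial_id {p}" using xy(1) C(2) unfolding E D by blast
        obtain q where q: "q \<in> verts S" "y = partial_id {q}" using xy(2) C(2) unfolding E D by blast
        have "{p} \<in> idem_domains" "{q} \<in> idem_domains" using p q by (auto simp: D)
        then show ?thesis using C(4)[of x y] xy unfolding p q by (auto simp: natural_le_partial_id)
      qed
      then have "card (C - {partial_id {}}) \<le> 1"
        using card_le_Suc0_iff_eq[of "C - {partial_id {}}"] C(3) by simp
      then show "n \<le> 2" using card_Diff_singleton_if[of C "partial_id {}"] C(1) by (auto split: if_splits)
    next
      have m: "{} \<in> idem_domains" "{base S} \<in> idem_domains" using base_verts by (auto simp: D)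
      then have "fin_chain_in ?le E {partial_id {}, partial_id {base S}}"
        unfolding fin_chain_in_def E by (auto simp: natural_le_partial_id)
      moreover have "card {partial_id {}, partial_id {base S}} = 2" by (simp add: partial_id_inject)
      ultimately show "2 \<in> card ` ?CH" by (metis image_eqI mem_Collect_eq)
    qed
    ultimately show "k = 2 \<and> card E = card (verts S) + 1" using k cardE by simp
  next
    assume R: "k = 2 \<and> card E = card (verts S) + 1"
    have "separated"
    proof (rule idem_domains_imp_separated[OF assms(1)])
      show "card idem_domains = card (verts S) + 1" using R cardE by simp
    next
      fix D D' assume D: "{} \<in> idem_domains" "D \<in> idem_domains" "D' \<in> idem_domains" "D \<noteq> {}" "D \<subseteq> D'"
      show "D = D'"
      proof (rule ccontr)
        assume "D \<noteq> D'"
        have "D' \<noteq> {}" using D(4,5) by blast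
        \<comment> \<open>A proper inclusion of nonempty domains extends the bottom element to a
          chain of size 3.\<close>
        have "fin_chain_in ?le E {partial_id {}, partial_id D, partial_id D'}"
          unfolding fin_chain_in_def E using D by (auto simp: natural_le_partial_id)
        moreover have "card {partial_id {}, partial_id D, partial_id D'} = 3"
          using D(4)[symmetric] \<open>D' \<noteq> {}\<close>[symmetric] \<open>D \<noteq> D'\<close> by (simp add: partial_id_inject)
        ultimately have "3 \<in> card ` ?CH" by (metis image_eqI mem_Collect_eq)
        then have "3 \<le> k" unfolding k by (rule Max_ge[OF finCH])
        then show False using R by simp
      qed
    qed
    then show "malnormal (free_group A) K" by (rule separated_imp_malnormal)
  qed
qed

end

theorem theorem6p9:
  fixes A :: "'a set"
    and K :: "'a letter list set"
    and S :: "(nat \<times> nat, 'a) automaton"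
    and E :: "(nat \<times> nat \<rightharpoonup> nat \<times> nat) set"
    and k :: nat
  assumes "finite A"
    and "subgroup K (free_group A)"
    and "fin_gen_subgroup (free_group A) K"
    and "K \<noteq> {\<one>\<^bsub>free_group A\<^esub>}"
    and "K \<noteq> carrier (free_group A)"
    and "stallings_automaton A K S"
    and "E = {delta S u | u. u \<in> reduced_words A - {[]} \<and>
            delta S u \<otimes>\<^bsub>transition_monoid A S\<^esub> delta S u = delta S u}"
    and "k = Max (card ` {C. fin_chain_in (natural_le (transition_monoid A S)) E C})"
  shows "malnormal (free_group A) K \<longleftrightarrow> k = 2 \<and> card E = card (verts S) + 1"
proof -
  interpret stallings A K S using assms(6) by (rule stallings_stallings_automaton)
  show ?thesis
    by (rule malnormal_iff) (use assms(4,5,7,8) idempotents_eq in simp_all)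
qed

end
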